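(* Let $G$ be a group of order $2^m$ of rank $4$. Then (1) $\displaystyle A_G(t/|G|)=\frac{1-2^{-1}}{1-2^{-2}t} + \frac{2^{-1}-2^{-3}}{1-2^{-1}t} + \frac{2^{-3}}{1-t}$; (2) $\displaystyle B_G(t/|G|)=\frac{-2^{-1}}{1-2^{-3}t} + \frac{1}{1-2^{-2}t} + \frac{2^{-1}}{1-2^{-1}t}$.
   Context: For a finite group $G$ and $n\ge 0$, $\alpha_{G,n}$ denotes the number of orbits of $G$ acting on $G^n$ by simultaneous conjugation $g\cdot(x_1,\dots,x_n)=(gx_1g^{-1},\dots,gx_ng^{-1})$, and $\beta_{G,n}$ denotes the number of orbits of the same action on the set $G^{(n)}$ of $n$-tuples of pairwise commuting elements of $G$; $\alpha_{G,0}=\beta_{G,0}=1$. Set $A_G(t)=\sum_{n\ge 0}\alpha_{G,n}t^n$ and $B_G(t)=\sum_{n\ge 0}\beta_{G,n}t^n$ (formal power series, which are rational functions of $t$). $A_G(t/|G|)$, $B_G(t/|G|)$ denote the result of substituting $t/|G|$ for $t$. Finite groups $G,H$ are isoclinic if there are isomorphisms $\theta:G/Z(G)\to H/Z(H)$ and $\phi:G'\to H'$ (derived subgroups) such that $\phi([g_1,g_2])=[h_1,h_2]$ whenever $\theta(g_iZ(G))=h_iZ(H)$ for $i=1,2$. Isoclinism is an equivalence relation, whose classes are called isoclinism families. For a finite $2$-group $G$, the rank of (the family of) $G$ is the smallest $r$ such that the isoclinism family of $G$ contains a group of order $2^r$; equivalently $2^r=|G/Z(G)|\,|Z(G)\cap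 G'|$. *)

theory Defs
  imports "HOL-Algebra.Algebra" "HOL-Computational_Algebra.Formal_Power_Series"
begin

definition tuples :: "('a, 'b) monoid_scheme \<Rightarrow> nat \<Rightarrow> 'a list set" where
  "tuples G n = {xs. length xs = n \<and> set xs \<subseteq> carrier G}"

definition commuting_tuples :: "('a, 'b) monoid_scheme \<Rightarrow> nat \<Rightarrow> 'a list set" where
  "commuting_tuples G n =
     {xs \<in> tuples G n. \<forall>x\<in>set xs. \<forall>y\<in>set xs. x \<otimes>\<^bsub>G\<^esub> y = y \<otimes>\<^bsub>G\<^esub> x}"

text \<open>As for the conjugation actions in the library, each map is restricted to the set acted
  upon, because \<^locale>\<open>group_action\<close> asks for extensional bijections.\<close>

definition simultaneous_conj ::
    "('a, 'b) monoid_scheme \<Rightarrow> 'a list set \<Rightarrow> 'a \<Rightarrow> 'a list \<Rightarrow> 'a list" where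
  "simultaneous_conj G E g = (\<lambda>xs\<in>E. map (\<lambda>x. g \<otimes>\<^bsub>G\<^esub> x \<otimes>\<^bsub>G\<^esub> inv\<^bsub>G\<^esub> g) xs)"

definition alpha :: "('a, 'b) monoid_scheme \<Rightarrow> nat \<Rightarrow> nat" where
  "alpha G n = card (orbits G (tuples G n) (simultaneous_conj G (tuples G n)))"

definition beta :: "('a, 'b) monoid_scheme \<Rightarrow> nat \<Rightarrow> nat" where
  "beta G n = card (orbits G (commuting_tuples G n) (simultaneous_conj G (commuting_tuples G n)))"

definition A_series :: "('a, 'b) monoid_scheme \<Rightarrow> rat fps" where
  "A_series G = Abs_fps (\<lambda>n. of_nat (alpha G n))"

definition B_series :: "('a, 'b) monoid_scheme \<Rightarrow> rat fps" where
  "B_series G = Abs_fps (\<lambda>n. of_nat (beta G n))"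

definition group_center :: "('a, 'b) monoid_scheme \<Rightarrow> 'a set" where
  "group_center G = {z \<in> carrier G. \<forall>x\<in>carrier G. z \<otimes>\<^bsub>G\<^esub> x = x \<otimes>\<^bsub>G\<^esub> z}"

definition derived_subgroup :: "('a, 'b) monoid_scheme \<Rightarrow> ('a, 'b) monoid_scheme" where
  "derived_subgroup G = G\<lparr>carrier := derived G (carrier G)\<rparr>"

text \<open>The convention is that of \<^const>\<open>derived_set\<close>.\<close>

definition commutator :: "('a, 'b) monoid_scheme \<Rightarrow> 'a \<Rightarrow> 'a \<Rightarrow> 'a" where
  "commutator G x y = x \<otimes>\<^bsub>G\<^esub> y \<otimes>\<^bsub>G\<^esub> inv\<^bsub>G\<^esub> x \<otimes>\<^bsub>G\<^esub> inv\<^bsub>G\<^esub> y"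

definition isoclinic :: "('a, 'b) monoid_scheme \<Rightarrow> ('c, 'd) monoid_scheme \<Rightarrow> bool" where
  "isoclinic G H \<longleftrightarrow>
     (\<exists>\<theta> \<in> iso (G Mod group_center G) (H Mod group_center H).
      \<exists>\<phi> \<in> iso (derived_subgroup G) (derived_subgroup H).
        \<forall>g1\<in>carrier G. \<forall>g2\<in>carrier G. \<forall>h1\<in>carrier H. \<forall>h2\<in>carrier H.
          \<theta> (group_center G #>\<^bsub>G\<^esub> g1) = group_center H #>\<^bsub>H\<^esub> h1 \<longrightarrow>
          \<theta> (group_center G #>\<^bsub>G\<^esub> g2) = group_center H #>\<^bsub>H\<^esub> h2 \<longrightarrow>
          \<phi> (commutator G g1 g2) = commutator H h1 h2)"

text \<open>The family ranges over finite groups whose elements are natural numbers. Every finite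
  group is isomorphic to one of these, so no order of a member is lost.\<close>

definition isoclinism_family :: "('a, 'b) monoid_scheme \<Rightarrow> nat monoid set" where
  "isoclinism_family G = {H. group H \<and> finite (carrier H) \<and> isoclinic G H}"

text \<open>Meaningful for finite 2-groups \<open>G\<close>: the family then contains a copy of \<open>G\<close>, so that the
  minimum is taken over a nonempty set.\<close>

definition family_rank :: "('a, 'b) monoid_scheme \<Rightarrow> nat" where
  "family_rank G = (LEAST r. \<exists>H\<in>isoclinism_family G. order H = 2 ^ r)"

text \<open>\<open>rescale c F\<close> is \<open>F(c t)\<close>.\<close>

definition rescale :: "rat \<Rightarrow> rat fps \<Rightarrow> rat fps" where
  "rescale c F = fps_compose F (fps_const c * fps_X)"

text \<open>\<open>simple_fraction a c\<close> is the rational function \<open>a / (1 - c t)\<close>, expanded at \<open>t = 0\<close>.\<close>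

definition simple_fraction :: "rat \<Rightarrow> rat \<Rightarrow> rat fps" where
  "simple_fraction a c = fps_const a / (1 - fps_const c * fps_X)"

lemma (in group) simultaneous_conj_action:
  assumes "E = tuples G n \<or> E = commuting_tuples G n"
  shows "group_action G E (simultaneous_conj G E)"
proof -
  let ?c = "\<lambda>g x. g \<otimes> x \<otimes> inv g"
  have cancel: "g \<otimes> (inv g \<otimes> x) = x" "inv g \<otimes> (g \<otimes> x) = x"
    if "g \<in> carrier G" "x \<in> carrier G" for g x
    using that by (simp_all add: m_assoc[symmetric])
  have E_carrier: "set xs \<subseteq> carrier G" if "xs \<in> E" for xs
    using that assms by (auto simp: tuples_def commuting_tuples_def)
  have c_mult: "?c g x \<otimes> ?c g y = ?c g (x \<otimes> y)"
    if "g \<in> carrier G" "x \<in> carrier G" "y \<in> carrier G" for g x y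
    using that by (simp add: m_assoc cancel)
  have closed: "map (?c g) xs \<in> E" if g: "g \<in> carrier G" and xs: "xs \<in> E" for g xs
  proof -
    have sub: "set xs \<subseteq> carrier G" using E_carrier xs .
    have "map (?c g) xs \<in> tuples G n"
      using assms xs g by (auto simp: tuples_def commuting_tuples_def)
    moreover have "map (?c g) xs \<in> commuting_tuples G n" if "E = commuting_tuples G n"
    proof -
      have "?c g x \<otimes> ?c g y = ?c g y \<otimes> ?c g x" if "x \<in> set xs" "y \<in> set xs" for x y
      proof -
        have "x \<otimes> y = y \<otimes> x"
          using xs \<open>E = commuting_tuples G n\<close> that by (auto simp: commuting_tuples_def)
        moreover have "x \<in> carrier G" "y \<in> carrier G" using sub that by auto
        ultimately show ?thesis using g by (simp only: c_mult)
      qed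
      then show ?thesis using calculation by (auto simp: commuting_tuples_def)
    qed
    ultimately show ?thesis using assms by auto
  qed
  have comp: "map (?c (g \<otimes> h)) xs = map (?c g) (map (?c h) xs)"
    if "g \<in> carrier G" "h \<in> carrier G" "xs \<in> E" for g h xs
    using that E_carrier[OF that(3)] by (auto simp: inv_mult_group m_assoc subset_iff)
  have one: "map (?c \<one>) xs = xs" if "xs \<in> E" for xs
    using E_carrier[OF that] by (auto intro!: map_idI)
  have inverse: "map (?c (inv g)) (map (?c g) xs) = xs" "map (?c g) (map (?c (inv g)) xs) = xs"
    if "g \<in> carrier G" "xs \<in> E" for g xs
  proof -
    have "map (?c (inv g)) (map (?c g) xs) = map (?c (inv g \<otimes> g)) xs"
      using comp[of "inv g" g xs] that by (simp only: inv_closed)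
    then show "map (?c (inv g)) (map (?c g) xs) = xs"
      using one[of xs] that by (simp only: l_inv)
    have "map (?c g) (map (?c (inv g)) xs) = map (?c (g \<otimes> inv g)) xs"
      using comp[of g "inv g" xs] that by (simp only: inv_closed)
    then show "map (?c g) (map (?c (inv g)) xs) = xs"
      using one[of xs] that by (simp only: r_inv)
  qed
  have bij: "simultaneous_conj G E g \<in> Bij E" if g: "g \<in> carrier G" for g
  proof -
    have "bij_betw (simultaneous_conj G E g) E E"
      by (rule bij_betw_byWitness[where f' = "map (?c (inv g))"])
        (use g closed[OF g] closed[OF inv_closed[OF g]] inverse[OF g] in
          \<open>auto simp: simultaneous_conj_def simp del: map_map inv_inv\<close>)
    then show ?thesis by (simp add: Bij_def simultaneous_conj_def)
  qed
  have "simultaneous_conj G E \<in> hom G (BijGroup E)"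
  proof (rule homI)
    show "simultaneous_conj G E g \<in> carrier (BijGroup E)" if "g \<in> carrier G" for g
      using bij that by (simp add: BijGroup_def)
    show "simultaneous_conj G E (g \<otimes> h) =
        simultaneous_conj G E g \<otimes>\<^bsub>BijGroup E\<^esub> simultaneous_conj G E h"
      if "g \<in> carrier G" "h \<in> carrier G" for g h
      using that bij closed comp
      by (auto simp: BijGroup_def compose_def simultaneous_conj_def fun_eq_iff simp del: map_map)
  qed
  then show ?thesis
    by (simp add: group_action_def group_hom_def group_hom_axioms_def group_BijGroup)
qed

lemma (in group) group_center_normal: "group_center G \<lhd> G"
proof -
  have sub: "subgroup (group_center G) G"
  proof (rule subgroupI)
    show "inv a \<in> group_center G" if "a \<in> group_center G" for a
      using that by (auto simp: group_center_def)
        (metis inv_closed inv_inv inv_mult_group)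
    show "a \<otimes> b \<in> group_center G" if "a \<in> group_center G" "b \<in> group_center G" for a b
    proof -
      have ab: "a \<in> carrier G" "b \<in> carrier G" using that by (auto simp: group_center_def)
      have "a \<otimes> b \<otimes> x = x \<otimes> (a \<otimes> b)" if x: "x \<in> carrier G" for x
      proof -
        have "a \<otimes> x = x \<otimes> a" "b \<otimes> x = x \<otimes> b"
          using \<open>a \<in> group_center G\<close> \<open>b \<in> group_center G\<close> x
          by (simp_all add: group_center_def)
        then show ?thesis using ab x by (metis m_assoc)
      qed
      then show ?thesis using ab by (simp add: group_center_def)
    qed
  qed (auto simp: group_center_def)
  show ?thesis
    by (rule normalI[OF sub]) (auto simp: group_center_def r_coset_def l_coset_def)
qed

lemma simple_fraction_nth: "fps_nth (simple_fraction a c) n = a * c ^ n"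
proof -
  define P where "P = Abs_fps (\<lambda>k. c ^ k)"
  have "P * (1 - fps_const c * fps_X) = P - fps_const c * (P * fps_X)"
    by (simp add: algebra_simps)
  also have "\<dots> = 1"
  proof (rule fps_ext)
    show "fps_nth (P - fps_const c * (P * fps_X)) k = fps_nth 1 k" for k
      by (cases k) (simp_all add: P_def)
  qed
  finally have "inverse (1 - fps_const c * fps_X) = P"
    by (intro fps_inverse_unique) (simp only: mult.commute)
  then show ?thesis
    by (simp add: simple_fraction_def fps_divide_unit P_def)
qed

lemma rescale_nth: "fps_nth (rescale c F) n = c ^ n * fps_nth F n"
  unfolding rescale_def by (simp add: fps_compose_linear)

end

theory Submission
  imports Defs "HOL-Algebra.Weak_Morphisms"
begin

text \<open>Burnside's lemma expresses \<open>\<alpha>\<close> and \<open>\<beta>\<close> through the commuting relation of \<open>G\<close>, and this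
  relation lives on \<open>G/Z(G)\<close>, where isoclinism preserves it. So it suffices to know the relation
  for one member \<open>H\<close> of order 16 of the family. If \<open>H\<close> is abelian it is isoclinic to the trivial
  group, and if its center has index 4 it is isoclinic to the dihedral group of order 8; both
  contradict rank 4. Hence \<open>Z(H)\<close> has order 2. By the class equation some centralizer \<open>A\<close> has
  index 2; it is abelian, and an element outside \<open>A\<close> commutes only with its own coset of the
  center and the center itself.\<close>

section \<open>Centers, centralizers and commutators\<close>

text \<open>The order of \<open>G\<close>, hence of its center, is not bounded: rank 4 controls only
  the representative of order 16. Therefore every count for \<open>G\<close> is made in cosets of
  the center, with z = |Z(G)| as a parameter. The counts are combinations of powers of multiples of
  z, and substituting t/|G| with |G| = 8z cancels z; this is why the answer depends on the family
  alone. The constants are proportions. Central elements, the rest of the abelian subgroup, and its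
  complement make up 1/8, 3/8 and 1/2 of the group, and their centralizers have relative size 1, 1/2
  and 1/4: these are the coefficients and the ratios of the geometric series in the first formula.
  For the second, Burnside's lemma turns |G| times the n-th number of orbits into the number of
  commuting (n+1)-tuples. Such a tuple lies in the abelian subgroup or in the union of the center
  with one of the four outer cosets; counting tuples of central elements once gives (4z)^(n+1) +
  4((2z)^(n+1) - z^(n+1)). Division by (8z)^(n+1) yields the coefficients 1/2, 1 and -1/2.\<close>

definition centralizer :: "('a, 'b) monoid_scheme \<Rightarrow> 'a \<Rightarrow> 'a set" where
  "centralizer G x = {y \<in> carrier G. x \<otimes>\<^bsub>G\<^esub> y = y \<otimes>\<^bsub>G\<^esub> x}"

context group
begin

lemma subgroup_group_center: "subgroup (group_center G) G"
  using group_center_normal by (rule normal_imp_subgroup)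

lemma group_center_subset: "group_center G \<subseteq> carrier G"
  by (auto simp: group_center_def)

lemma mem_centralizer_sym:
  "x \<in> carrier G \<Longrightarrow> y \<in> carrier G \<Longrightarrow> y \<in> centralizer G x \<longleftrightarrow> x \<in> centralizer G y"
  by (auto simp: centralizer_def)

lemma centralizer_self: "x \<in> carrier G \<Longrightarrow> x \<in> centralizer G x"
  by (simp add: centralizer_def)

lemma group_center_subset_centralizer:
  "x \<in> carrier G \<Longrightarrow> group_center G \<subseteq> centralizer G x"
  by (auto simp: centralizer_def group_center_def)

lemma centralizer_eq_carrier_iff:
  "x \<in> carrier G \<Longrightarrow> centralizer G x = carrier G \<longleftrightarrow> x \<in> group_center G"
  by (auto simp: centralizer_def group_center_def)

lemma subgroup_centralizer:
  assumes x: "x \<in> carrier G"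
  shows "subgroup (centralizer G x) G"
proof (rule subgroupI)
  fix a b assume ab: "a \<in> centralizer G x" "b \<in> centralizer G x"
  then have c: "a \<in> carrier G" "b \<in> carrier G" "x \<otimes> a = a \<otimes> x" "x \<otimes> b = b \<otimes> x"
    by (auto simp: centralizer_def)
  have "x \<otimes> (a \<otimes> b) = a \<otimes> b \<otimes> x"
    using x c by (metis m_assoc)
  then show "a \<otimes> b \<in> centralizer G x" using c by (simp add: centralizer_def)
next
  fix a assume "a \<in> centralizer G x"
  then have c: "a \<in> carrier G" "x \<otimes> a = a \<otimes> x"
    by (auto simp: centralizer_def)
  have "inv a \<otimes> x = inv a \<otimes> (x \<otimes> a) \<otimes> inv a" using x c(1) by (simp add: m_assoc)
  also have "\<dots> = x \<otimes> inv a" using x c by (simp add: m_assoc[symmetric])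
  finally have "x \<otimes> inv a = inv a \<otimes> x" ..
  then show "inv a \<in> centralizer G x" using c by (simp add: centralizer_def)
qed (use x in \<open>auto simp: centralizer_def\<close>)

lemma conj_eq_iff_mem_centralizer:
  assumes "g \<in> carrier G" "x \<in> carrier G"
  shows "g \<otimes> x \<otimes> inv g = x \<longleftrightarrow> x \<in> centralizer G g"
  using assms inv_solve_right[of x "g \<otimes> x" g] by (auto simp: centralizer_def)

lemma subgroup_card_dvd:
  assumes "subgroup S G" "subgroup T G" "S \<subseteq> T"
  shows "card S dvd card T"
proof -
  have "group (G\<lparr>carrier := T\<rparr>)" using assms(2) by (rule subgroup_imp_group)
  then have "card (rcosets\<^bsub>G\<lparr>carrier := T\<rparr>\<^esub> S) * card S = order (G\<lparr>carrier := T\<rparr>)"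
    using group.lagrange subgroup_incl[OF assms] by blast
  then have "card (rcosets\<^bsub>G\<lparr>carrier := T\<rparr>\<^esub> S) * card S = card T" by (simp add: order_def)
  then show ?thesis by (metis dvd_triv_right)
qed

lemma card_subgroup_dvd_order: "subgroup S G \<Longrightarrow> card S dvd order G"
  using lagrange by (metis dvd_triv_right)

lemma r_coset_eq_iff:
  assumes "subgroup S G" "x \<in> carrier G" "y \<in> carrier G"
  shows "S #> x = S #> y \<longleftrightarrow> x \<otimes> inv y \<in> S"
proof
  assume "S #> x = S #> y"
  then have "x \<in> S #> y" using assms rcos_self by blast
  then obtain s where s: "s \<in> S" "x = s \<otimes> y" by (auto simp: r_coset_def)
  then show "x \<otimes> inv y \<in> S"
    using assms by (metis inv_solve_right subgroup.mem_carrier m_closed)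
next
  assume *: "x \<otimes> inv y \<in> S"
  have "x = x \<otimes> inv y \<otimes> y" using assms by (simp add: m_assoc)
  then have "x \<in> S #> y" using * by (auto simp: r_coset_def)
  then show "S #> x = S #> y" using assms repr_independence by metis
qed

lemma r_coset_eq_self_iff:
  assumes "subgroup S G" "x \<in> carrier G"
  shows "S #> x = S \<longleftrightarrow> x \<in> S"
  using assms coset_join1 coset_join2 by blast

text \<open>Since \<open>x\<close> is a central multiple of \<open>y\<close>, whatever commutes with
  \<open>y\<close> commutes with \<open>x\<close>, and conversely. This makes commutation a relation
  on cosets of the center.\<close>

lemma centralizer_r_coset:
  assumes "x \<in> carrier G" "y \<in> carrier G" "group_center G #> x = group_center G #> y"
  shows "centralizer G x = centralizer G y"
proof -
  have *: "centralizer G y \<subseteq> centralizer G x"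
    if x: "x \<in> carrier G" and y: "y \<in> carrier G" 
      and e: "group_center G #> x = group_center G #> y" for x y
  proof
    fix w assume w: "w \<in> centralizer G y"
    have "x \<in> group_center G #> y" using e x rcos_self subgroup_group_center by blast
    then obtain z where z: "z \<in> group_center G" "x = z \<otimes> y" by (auto simp: r_coset_def)
    have "z \<in> centralizer G w" "y \<in> centralizer G w"
      using z w y group_center_subset_centralizer mem_centralizer_sym
      by (auto simp: centralizer_def)
    then have "x \<in> centralizer G w"
      using w z subgroup.m_closed[OF subgroup_centralizer] by (auto simp: centralizer_def)
    then show "w \<in> centralizer G x" using x w by (auto simp: centralizer_def)
  qed
  from *[OF assms] *[OF assms(2,1) assms(3)[symmetric]] show ?thesis by blast
qed

lemma r_coset_subset_centralizer:
  assumes "x \<in> carrier G"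
  shows "group_center G #> x \<subseteq> centralizer G x"
proof
  fix y assume y: "y \<in> group_center G #> x"
  then have yc: "y \<in> carrier G"
    using assms group_center_subset r_coset_subset_G by blast
  have "group_center G #> x = group_center G #> y"
    using y assms subgroup_group_center repr_independence by blast
  then show "y \<in> centralizer G x"
    using centralizer_r_coset[OF assms yc] centralizer_self[OF yc] by simp
qed

lemma card_Union_rcosets:
  assumes "subgroup S G" "finite (carrier G)" "C \<subseteq> rcosets S"
  shows "card (\<Union>C) = card S * card C"
proof -
  have "\<Union>C \<subseteq> carrier G" using assms rcosets_part_G by blast
  then have fin: "finite (\<Union>C)" using assms(2) finite_subset by blast
  then have "finite C" using finite_UnionD by blast
  then have "card S * card C = card (\<Union>C)"
    using fin
  proof (rule card_partition)
    show "card c = card S" if "c \<in> C" for c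
      using that assms card_rcosets_equal subgroup.subset by (metis subsetD)
    show "c1 \<inter> c2 = {}" if "c1 \<in> C" "c2 \<in> C" "c1 \<noteq> c2" for c1 c2
      using that assms(3) rcos_disjoint[OF assms(1)] by (metis disjnt_def pairwiseD subsetD)
  qed
  then show ?thesis ..
qed

lemma card_center_Un_coset:
  assumes "finite (carrier G)" "R \<in> rcosets (group_center G)" "R \<noteq> group_center G"
  shows "card (group_center G \<union> R) = 2 * card (group_center G)"
proof -
  have "card (\<Union>{group_center G, R}) = card (group_center G) * card {group_center G, R}"
    using assms subgroup.subgroup_in_rcosets[OF subgroup_group_center is_group]
    by (intro card_Union_rcosets subgroup_group_center) auto
  then show ?thesis using assms(3) by simp
qed

text \<open>A noncentral \<open>x\<close> lies in its centralizer but not in the center, and its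
  centralizer is not the whole group, so both inclusions are strict. The index \<open>k\<close> of
  the center in the centralizer is thus a proper divisor of \<open>n\<close>, which leaves few cases
  when \<open>n\<close> is a small power of 2.\<close>

lemma group_center_index_noncentral:
  assumes fin: "finite (carrier G)" and ord: "order G = n * card (group_center G)"
    and x: "x \<in> carrier G" "x \<notin> group_center G"
  obtains k where "card (centralizer G x) = k * card (group_center G)" "k dvd n" "1 < k" "k < n"
proof -
  let ?Z = "group_center G" and ?C = "centralizer G x"
  have finC: "finite ?C" "finite ?Z"
    using fin group_center_subset finite_subset by (auto simp: centralizer_def)
  have z: "card ?Z > 0"
    using finC subgroup.one_closed[OF subgroup_group_center] card_gt_0_iff by blast
  have "card ?Z dvd card ?C"
    using subgroup_card_dvd subgroup_centralizer subgroup_group_center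
      group_center_subset_centralizer x by blast
  then obtain k where k: "card ?C = k * card ?Z" by (metis dvd_def mult.commute)
  moreover have "k dvd n"
    using card_subgroup_dvd_order[OF subgroup_centralizer[OF x(1)]] z ord k by simp
  moreover have "card ?Z < card ?C"
    using group_center_subset_centralizer centralizer_self x finC
    by (intro psubset_card_mono) auto
  moreover have "card ?C < order G" unfolding order_def
    using centralizer_eq_carrier_iff x fin
    by (intro psubset_card_mono) (auto simp: centralizer_def)
  ultimately show thesis using that ord by simp
qed

text \<open>With only two cosets, all elements outside \<open>S\<close> share one of them.
  Membership in \<open>S\<close> therefore behaves like parity, a homomorphism to the group of order
  2.\<close>

lemma index_two_mult_mem_iff:
  assumes S: "subgroup S G" and ord: "order G = 2 * card S" and fin: "finite (carrier G)"
    and xy: "x \<in> carrier G" "y \<in> carrier G"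
  shows "x \<otimes> y \<in> S \<longleftrightarrow> (x \<in> S \<longleftrightarrow> y \<in> S)"
proof -
  have "finite S" using S fin by (meson finite_subset subgroup.subset)
  then have "card S > 0" using subgroup.one_closed[OF S] by (auto simp: card_gt_0_iff)
  then have two: "card (rcosets S) = 2"
    using lagrange[OF S] ord by simp
  have r: "S #> w \<in> rcosets S" if "w \<in> carrier G" for w
    using that by (auto simp: RCOSETS_def)
  have eq: "S #> u = S #> v" if "u \<in> carrier G" "v \<in> carrier G" "u \<notin> S" "v \<notin> S" for u v
  proof (rule ccontr)
    assume "S #> u \<noteq> S #> v"
    moreover have "S #> u \<noteq> S" "S #> v \<noteq> S"
      using that r_coset_eq_self_iff[OF S] by blast+
    ultimately have "card {S, S #> u, S #> v} = 3" by simp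
    moreover have "{S, S #> u, S #> v} \<subseteq> rcosets S"
      using r that subgroup.subgroup_in_rcosets[OF S is_group] by auto
    ultimately show False
      using two card_mono[of "rcosets S" "{S, S #> u, S #> v}"] card_ge_0_finite[of "rcosets S"]
      by simp
  qed
  have iy: "inv y \<in> S \<longleftrightarrow> y \<in> S" 
    using xy S subgroup.m_inv_closed by (metis inv_inv)
  have "x \<otimes> y \<in> S" if "x \<notin> S" "y \<notin> S"
    using eq[of x "inv y"] that iy xy r_coset_eq_iff[OF S, of x "inv y"] by simp
  moreover have "x \<otimes> y \<in> S" if "x \<in> S" "y \<in> S"
    using subgroup.m_closed[OF S that] .
  moreover have "x \<in> S" if "x \<otimes> y \<in> S" "y \<in> S"
    using subgroup.m_closed[OF S that(1), of "inv y"] that iy xy by (simp add: m_assoc)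
  moreover have "y \<in> S" if "x \<otimes> y \<in> S" "x \<in> S"
    using subgroup.m_closed[OF S subgroup.m_inv_closed[OF S that(2)] that(1)] xy 
    by (simp add: m_assoc[symmetric])
  ultimately show ?thesis by blast
qed

section \<open>Commutators and their dependence on cosets of the center\<close>

lemma commutator_closed:
  "x \<in> carrier G \<Longrightarrow> y \<in> carrier G \<Longrightarrow> commutator G x y \<in> carrier G"
  by (simp add: commutator_def)

lemma commutator_eq_iff:
  assumes "x \<in> carrier G" "y \<in> carrier G" "c \<in> carrier G"
  shows "commutator G x y = c \<longleftrightarrow> x \<otimes> y = c \<otimes> (y \<otimes> x)"
proof -
  have "commutator G x y = x \<otimes> y \<otimes> inv (y \<otimes> x)"
    using assms by (simp add: commutator_def inv_mult_group m_assoc)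
  then show ?thesis using assms inv_solve_right[of c "x \<otimes> y" "y \<otimes> x"] by auto
qed

lemma commutator_eq_one_iff:
  assumes "x \<in> carrier G" "y \<in> carrier G"
  shows "commutator G x y = \<one> \<longleftrightarrow> x \<otimes> y = y \<otimes> x"
  using assms commutator_eq_iff[of x y \<one>] by simp

lemma inv_commutator:
  assumes "x \<in> carrier G" "y \<in> carrier G"
  shows "inv (commutator G x y) = commutator G y x"
  using assms by (simp add: commutator_def inv_mult_group m_assoc)

lemma derived_eq_generate_commutators:
  "derived G (carrier G) = generate G {commutator G x y |x y. x \<in> carrier G \<and> y \<in> carrier G}"
  unfolding derived_def commutator_def by (rule arg_cong[of _ _ "generate G"]) auto

lemma commutator_mem_derived:
  "x \<in> carrier G \<Longrightarrow> y \<in> carrier G \<Longrightarrow> commutator G x y \<in> derived G (carrier G)"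
  unfolding derived_eq_generate_commutators by (auto intro: generate.incl)

lemma commutator_r_coset_left:
  assumes "x \<in> carrier G" "y \<in> carrier G" "z \<in> group_center G"
  shows "commutator G (z \<otimes> x) y = commutator G x y"
proof -
  have z: "z \<in> carrier G" "\<And>w. w \<in> carrier G \<Longrightarrow> z \<otimes> w = w \<otimes> z"
    using assms by (auto simp: group_center_def)
  let ?c = "commutator G x y"
  have c: "?c \<in> carrier G" using assms commutator_closed by blast
  have "x \<otimes> y = ?c \<otimes> (y \<otimes> x)" using commutator_eq_iff[of x y ?c] assms c by simp
  then have "z \<otimes> x \<otimes> y = z \<otimes> (?c \<otimes> (y \<otimes> x))" using assms z(1) m_assoc by metis
  also have "\<dots> = ?c \<otimes> (z \<otimes> y \<otimes> x)" using assms z c by (metis m_assoc m_closed)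
  also have "\<dots> = ?c \<otimes> (y \<otimes> (z \<otimes> x))" using assms z by (metis m_assoc)
  finally show ?thesis using commutator_eq_iff[of "z \<otimes> x" y ?c] assms z c by simp
qed

text \<open>Only the left argument needs a computation: inverting a commutator swaps its
  arguments.\<close>

lemma commutator_r_coset:
  assumes "x \<in> carrier G" "y \<in> carrier G" "x' \<in> carrier G" "y' \<in> carrier G"
    and "group_center G #> x = group_center G #> x'" "group_center G #> y = group_center G #> y'"
  shows "commutator G x y = commutator G x' y'"
proof -
  have left: "commutator G u w = commutator G v w"
    if "group_center G #> u = group_center G #> v" "u \<in> carrier G" "v \<in> carrier G" "w \<in> carrier G"
    for u v w
  proof -
    have "u \<in> group_center G #> v" using that rcos_self subgroup_group_center by metis
    then show ?thesis using that commutator_r_coset_left by (auto simp: r_coset_def)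
  qed
  have "commutator G x y = commutator G x' y" using left assms by blast
  also have "\<dots> = inv (commutator G y x')" using assms inv_commutator by simp
  also have "\<dots> = commutator G x' y'" using left[of y y' x'] assms inv_commutator by simp
  finally show ?thesis .
qed

lemma noncommuting_notin_center:
  assumes "x \<in> carrier G" "y \<in> carrier G" "x \<otimes> y \<noteq> y \<otimes> x"
  shows "x \<notin> group_center G" "y \<notin> group_center G"
  using assms unfolding group_center_def by (blast, metis (mono_tags, lifting) mem_Collect_eq)

text \<open>The factor \<open>s\<close> moves past \<open>x\<close>, and the central commutator
  moves past \<open>s\<close>. It serves to compare two elements that differ by a factor commuting
  with \<open>x\<close>.\<close>

lemma commutator_right_mult_centralizer:
  assumes "x \<in> carrier G" "y \<in> carrier G" "s \<in> centralizer G x"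
    and c: "commutator G x y \<in> group_center G"
  shows "commutator G x (s \<otimes> y) = commutator G x y"
proof -
  let ?c = "commutator G x y"
  have cc: "?c \<in> carrier G" and s: "s \<in> carrier G" "x \<otimes> s = s \<otimes> x" "s \<otimes> ?c = ?c \<otimes> s"
    using assms group_center_subset by (auto simp: centralizer_def group_center_def)
  have "x \<otimes> (s \<otimes> y) = s \<otimes> (x \<otimes> y)" using assms s by (metis m_assoc)
  also have "\<dots> = s \<otimes> (?c \<otimes> (y \<otimes> x))"
    using commutator_eq_iff[of x y ?c] assms cc by simp
  also have "\<dots> = ?c \<otimes> (s \<otimes> y \<otimes> x)" using assms s cc by (metis m_assoc m_closed)
  finally show ?thesis using commutator_eq_iff[of x "s \<otimes> y" ?c] assms s cc by simp
qed

end

section \<open>Groups whose center has index four\<close>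

locale center_index_four = group +
  assumes finite_carrier: "finite (carrier G)"
    and order_eq: "order G = 4 * card (group_center G)"
begin

lemma card_center_pos: "card (group_center G) > 0"
  using finite_carrier order_eq order_gt_0_iff_finite by simp

lemma card_centralizer_noncentral:
  assumes "x \<in> carrier G" "x \<notin> group_center G"
  shows "order G = 2 * card (centralizer G x)"
proof -
  obtain k where k: "card (centralizer G x) = k * card (group_center G)" "k dvd 4" "1 < k" "k < 4"
    using group_center_index_noncentral[OF finite_carrier order_eq assms] .
  have "k \<noteq> 3" using k(2) by (intro notI) simp
  with k have "k = 2" by simp
  then show ?thesis using k order_eq by simp
qed

lemma centralizer_mult_mem_iff:
  assumes "x \<in> carrier G" "x \<notin> group_center G" "y \<in> carrier G" "z \<in> carrier G"
  shows "y \<otimes> z \<in> centralizer G x \<longleftrightarrow> (y \<in> centralizer G x \<longleftrightarrow> z \<in> centralizer G x)"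
  using index_two_mult_mem_iff[OF subgroup_centralizer[OF assms(1)]
      card_centralizer_noncentral[OF assms(1,2)] finite_carrier assms(3,4)] .

lemma centralizer_inv_mem_iff:
  assumes "x \<in> carrier G" "y \<in> carrier G"
  shows "inv y \<in> centralizer G x \<longleftrightarrow> y \<in> centralizer G x"
  using subgroup.m_inv_closed[OF subgroup_centralizer[OF assms(1)]] assms(2) by (metis inv_inv)

text \<open>The centralizer has twice as many elements as the center, so the center and one further
  coset already fill it.\<close>

lemma centralizer_noncentral:
  assumes "x \<in> carrier G" "x \<notin> group_center G"
  shows "centralizer G x = group_center G \<union> (group_center G #> x)"
proof -
  let ?Z = "group_center G"
  have "?Z #> x \<noteq> ?Z" "?Z #> x \<in> rcosets ?Z"
    using assms r_coset_eq_self_iff[OF subgroup_group_center] by (auto simp: RCOSETS_def)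
  then have "card (?Z \<union> (?Z #> x)) = card (centralizer G x)"
    using card_center_Un_coset[OF finite_carrier] card_centralizer_noncentral[OF assms] order_eq by simp
  moreover have "?Z \<union> (?Z #> x) \<subseteq> centralizer G x"
    using assms group_center_subset_centralizer r_coset_subset_centralizer by simp
  moreover have "finite (centralizer G x)"
    using finite_carrier by (simp add: centralizer_def)
  ultimately show ?thesis by (metis card_subset_eq)
qed

lemma commute_iff:
  assumes "x \<in> carrier G" "y \<in> carrier G"
  shows "x \<otimes> y = y \<otimes> x \<longleftrightarrow> x \<in> group_center G \<or> y \<in> group_center G \<or>
    group_center G #> x = group_center G #> y"
proof
  assume "x \<otimes> y = y \<otimes> x"
  then have "y \<in> centralizer G x" using assms by (simp add: centralizer_def)
  then have "y \<in> group_center G #> x" if "x \<notin> group_center G" "y \<notin> group_center G"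
    using centralizer_noncentral that assms by blast
  then show "x \<in> group_center G \<or> y \<in> group_center G \<or> group_center G #> x = group_center G #> y"
    using repr_independence assms subgroup_group_center by metis
next
  assume "x \<in> group_center G \<or> y \<in> group_center G \<or> group_center G #> x = group_center G #> y"
  moreover have "y \<in> centralizer G x" if "group_center G #> x = group_center G #> y"
    using centralizer_r_coset[OF assms that] centralizer_self assms by simp
  ultimately show "x \<otimes> y = y \<otimes> x" using assms by (auto simp: group_center_def centralizer_def)
qed

text \<open>A noncentral element of both centralizers would lie in the cosets of \<open>a\<close>
  and of \<open>b\<close>; these would then coincide and \<open>a\<close> would commute with
  \<open>b\<close>.\<close>

lemma centralizer_Int_eq_center:
  assumes ab: "a \<in> carrier G" "b \<in> carrier G" "a \<otimes> b \<noteq> b \<otimes> a"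
  shows "centralizer G a \<inter> centralizer G b = group_center G"
proof -
  have nc: "a \<notin> group_center G" "b \<notin> group_center G"
    using noncommuting_notin_center[OF ab] .
  have "c \<in> group_center G" if "c \<in> centralizer G a" "c \<in> centralizer G b" for c
  proof (rule ccontr)
    assume "c \<notin> group_center G"
    then have "c \<in> group_center G #> a" "c \<in> group_center G #> b"
      using that centralizer_noncentral ab nc by auto
    then have "group_center G #> a = group_center G #> b"
      using repr_independence[OF _ _ subgroup_group_center] ab by metis
    then have "centralizer G a = centralizer G b" using centralizer_r_coset ab by blast
    then have "b \<in> centralizer G a" using centralizer_self ab by blast
    then show False using ab by (simp add: centralizer_def)
  qed
  then show ?thesis using group_center_subset_centralizer ab by blast
qed

text \<open>A parity argument: in a commutator each argument occurs once together with its inverse,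
  so the commutator lies in every index-two centralizer. For noncommuting \<open>x\<close> and
  \<open>y\<close> their two centralizers meet in the center.\<close>

lemma commutator_mem_center:
  assumes xy: "x \<in> carrier G" "y \<in> carrier G"
  shows "commutator G x y \<in> group_center G"
proof (cases "x \<otimes> y = y \<otimes> x")
  case True
  then show ?thesis
    using commutator_eq_one_iff[OF xy] subgroup.one_closed[OF subgroup_group_center] by simp
next
  case False
  then have nc: "x \<notin> group_center G" "y \<notin> group_center G"
    using noncommuting_notin_center[OF xy] by blast+
  have "commutator G x y \<in> centralizer G w" if "w \<in> {x, y}" for w
  proof -
    have "w \<in> carrier G" "w \<notin> group_center G" using that xy nc by auto
    then show ?thesis
      using xy by (auto simp: commutator_def centralizer_mult_mem_iff centralizer_inv_mem_iff)
  qed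
  then show ?thesis using centralizer_Int_eq_center[OF xy False] by blast
qed

text \<open>Both \<open>y\<close> and \<open>w\<close> lie outside the index-two subgroup
  \<open>centralizer G x\<close>, so their quotient lies inside and does not change the
  commutator.\<close>

lemma commutator_eq_of_noncommuting_right:
  assumes "x \<in> carrier G" "y \<in> carrier G" "w \<in> carrier G"
    and "x \<otimes> y \<noteq> y \<otimes> x" "x \<otimes> w \<noteq> w \<otimes> x"
  shows "commutator G x y = commutator G x w"
proof -
  have x: "x \<notin> group_center G" using assms by (auto simp: group_center_def)
  have "y \<otimes> inv w \<in> centralizer G x"
    using assms x by (simp add: centralizer_mult_mem_iff centralizer_inv_mem_iff)
      (simp add: centralizer_def)
  then have "commutator G x (y \<otimes> inv w \<otimes> w) = commutator G x w"
    using assms commutator_mem_center by (intro commutator_right_mult_centralizer) auto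
  then show ?thesis using assms by (simp add: m_assoc)
qed

lemma commutator_eq_of_noncommuting:
  assumes "x \<in> carrier G" "y \<in> carrier G" "x \<otimes> y \<noteq> y \<otimes> x"
    and "a \<in> carrier G" "b \<in> carrier G" "a \<otimes> b \<noteq> b \<otimes> a"
  shows "commutator G x y = commutator G a b"
proof -
  have nc: "x \<notin> group_center G" "a \<notin> group_center G"
    using assms by (auto simp: group_center_def)
  have right: "commutator G u v = commutator G u w"
    if "u \<in> carrier G" "v \<in> carrier G" "w \<in> carrier G"
      "v \<notin> centralizer G u" "w \<notin> centralizer G u" for u v w
    using commutator_eq_of_noncommuting_right[of u v w] that by (auto simp: centralizer_def)
  have left: "commutator G u w = commutator G v w"
    if "u \<in> carrier G" "v \<in> carrier G" "w \<in> carrier G"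
      "w \<notin> centralizer G u" "w \<notin> centralizer G v" for u v w
    using right[of w u v] that inv_commutator mem_centralizer_sym by metis
  have y: "y \<notin> centralizer G x" and b: "b \<notin> centralizer G a"
    using assms by (auto simp: centralizer_def)
  \<comment> \<open>A common partner \<open>w\<close> links the two commutators: [x,y] = [x,w] =
    [a,w] = [a,b]. One of \<open>b\<close> and \<open>y\<close> serves unless each commutes with the
    other's opponent; then \<open>y \<otimes> b\<close> has exactly one factor outside each of the
    two centralizers, hence lies outside both.\<close>
  obtain w where w: "w \<in> carrier G" "w \<notin> centralizer G x" "w \<notin> centralizer G a"
  proof (cases "b \<in> centralizer G x \<and> y \<in> centralizer G a")
    case True
    then show ?thesis
      using that[of "y \<otimes> b"] assms nc y b by (simp add: centralizer_mult_mem_iff)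
  qed (use that y b assms in blast)
  show ?thesis
    using right[of x y w] left[of x a w] right[of a w b] assms w y b by simp
qed

text \<open>The inverse is the commutator of the swapped pair, which again does not commute, so it
  is the same element.\<close>

lemma commutator_involution:
  assumes "a \<in> carrier G" "b \<in> carrier G" "a \<otimes> b \<noteq> b \<otimes> a"
  shows "commutator G a b \<otimes> commutator G a b = \<one>"
proof -
  have "inv (commutator G a b) = commutator G a b"
    using commutator_eq_of_noncommuting[of b a a b] assms inv_commutator by metis
  then show ?thesis using assms commutator_closed l_inv by metis
qed

lemma derived_eq:
  assumes ab: "a \<in> carrier G" "b \<in> carrier G" "a \<otimes> b \<noteq> b \<otimes> a"
  shows "derived G (carrier G) = {\<one>, commutator G a b}"
proof
  let ?c = "commutator G a b"
  have c: "?c \<in> carrier G" "?c \<otimes> ?c = \<one>"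
    using ab commutator_closed commutator_involution by auto
  then have "subgroup {\<one>, ?c} G"
    by (intro subgroupI) (auto simp: inv_equality)
  moreover have "commutator G x y \<in> {\<one>, ?c}" if "x \<in> carrier G" "y \<in> carrier G" for x y
    using that ab commutator_eq_one_iff commutator_eq_of_noncommuting by blast
  ultimately show "derived G (carrier G) \<subseteq> {\<one>, ?c}"
    unfolding derived_eq_generate_commutators by (intro generate_subgroup_incl) auto
  show "{\<one>, ?c} \<subseteq> derived G (carrier G)"
    using ab commutator_mem_derived derived_is_subgroup[of "carrier G"] subgroup.one_closed
    by auto
qed

lemma exists_noncommuting:
  obtains a b where "a \<in> carrier G" "b \<in> carrier G" "a \<otimes> b \<noteq> b \<otimes> a"
proof -
  have "group_center G \<noteq> carrier G"
    using order_eq card_center_pos by (auto simp: order_def)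
  then show thesis using that by (auto simp: group_center_def)
qed

end

text \<open>Truth values under exclusive or: a pair of membership tests for index-two subgroups
  takes its values here.\<close>

definition klein_four :: "(bool \<times> bool) monoid" where
  "klein_four = \<lparr>carrier = UNIV, monoid.mult = (\<lambda>(i, j) (k, l). (i \<noteq> k, j \<noteq> l)), one = (False, False)\<rparr>"

lemma group_klein_four: "group klein_four"
  by (rule groupI) (auto simp: klein_four_def)

context center_index_four
begin

text \<open>For noncommuting \<open>a\<close> and \<open>b\<close>, each coordinate tests membership
  in one of their centralizers and is a homomorphism by parity. The kernel is the intersection of
  the two centralizers, and \<one>, \<open>a\<close>, \<open>b\<close>, \<open>a \<otimes> b\<close>
  reach the four values.\<close>

lemma exists_hom_klein_four:
  obtains p where "p \<in> hom G klein_four" "p ` carrier G = UNIV"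
    "kernel G klein_four p = group_center G"
proof -
  obtain a b where ab: "a \<in> carrier G" "b \<in> carrier G" "a \<otimes> b \<noteq> b \<otimes> a"
    by (rule exists_noncommuting)
  then have nc: "a \<notin> group_center G" "b \<notin> group_center G"
    using noncommuting_notin_center by blast+
  have ba: "b \<notin> centralizer G a" "a \<notin> centralizer G b"
    using ab by (auto simp: centralizer_def)
  define p where "p x = (x \<notin> centralizer G a, x \<notin> centralizer G b)" for x
  have "p \<in> hom G klein_four"
    using ab nc by (auto simp: hom_def klein_four_def p_def centralizer_mult_mem_iff)
  moreover have "p ` carrier G = UNIV"
  proof -
    have "p \<one> = (False, False)" "p a = (False, True)" "p b = (True, False)"
      "p (a \<otimes> b) = (True, True)"
      using ab nc ba centralizer_self by (auto simp: p_def centralizer_mult_mem_iff)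
        (auto simp: centralizer_def)
    then have "{(False, False), (False, True), (True, False), (True, True)} \<subseteq> p ` carrier G"
      using ab by (metis (no_types, lifting) empty_subsetI image_eqI insert_subset m_closed one_closed)
    then have "\<forall>i j. (i, j) \<in> p ` carrier G" by (simp add: all_bool_eq)
    then show ?thesis by auto
  qed
  moreover have "kernel G klein_four p = group_center G"
    using centralizer_Int_eq_center[OF ab] group_center_subset
    by (auto simp: kernel_def klein_four_def p_def)
  ultimately show thesis by (rule that)
qed

text \<open>The criterion refers only to values in the four-group. Hence two groups with center of
  index four have the same commutation pattern, whichever such maps are chosen.\<close>

lemma commute_iff_hom:
  assumes p: "p \<in> hom G klein_four" "kernel G klein_four p = group_center G"
    and xy: "x \<in> carrier G" "y \<in> carrier G"
  shows "x \<otimes> y = y \<otimes> x \<longleftrightarrow>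
    p x = (False, False) \<or> p y = (False, False) \<or> p x = p y"
proof -
  interpret P: group_hom G klein_four p
    using p group_klein_four by (simp add: group_hom_def group_hom_axioms_def)
  have ker: "p g = (False, False) \<longleftrightarrow> g \<in> group_center G" if "g \<in> carrier G" for g
    using that p(2) by (auto simp: kernel_def klein_four_def)
  have minus: "p (x \<otimes> inv y) = (fst (p x) \<noteq> fst (p y), snd (p x) \<noteq> snd (p y))"
  proof -
    have "p (x \<otimes> inv y) \<otimes>\<^bsub>klein_four\<^esub> p y = p x"
      using xy by (simp flip: P.hom_mult add: m_assoc)
    then show ?thesis by (cases "p x"; cases "p y"; cases "p (x \<otimes> inv y)") (auto simp: klein_four_def)
  qed
  have "group_center G #> x = group_center G #> y \<longleftrightarrow> p x = p y"
    using r_coset_eq_iff[OF subgroup_group_center xy] ker[of "x \<otimes> inv y"] xy minus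
    by (auto simp: prod_eq_iff)
  then show ?thesis using commute_iff xy ker by simp
qed

end

section \<open>Isoclinism\<close>

text \<open>Avoids building the isomorphism of central quotients by hand: surjections of both groups
  onto a common \<open>V\<close>, with the centers as kernels, identify each quotient with
  \<open>V\<close>. The commutator condition then concerns elements with equal images.\<close>

lemma isoclinicI:
  fixes G :: "('a, 'b) monoid_scheme" and H :: "('c, 'd) monoid_scheme"
    and V :: "('e, 'f) monoid_scheme"
  assumes groups: "group G" "group H" "group V"
    and p: "p \<in> hom G V" "p ` carrier G = carrier V" "kernel G V p = group_center G"
    and q: "q \<in> hom H V" "q ` carrier H = carrier V" "kernel H V q = group_center H"
    and phi: "\<phi> \<in> iso (derived_subgroup G) (derived_subgroup H)"
    and comm: "\<And>g1 g2 h1 h2. \<lbrakk>g1 \<in> carrier G; g2 \<in> carrier G; h1 \<in> carrier H; h2 \<in> carrier H;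
        p g1 = q h1; p g2 = q h2\<rbrakk> \<Longrightarrow> \<phi> (commutator G g1 g2) = commutator H h1 h2"
  shows "isoclinic G H"
proof -
  interpret P: group_hom G V p using groups p by (simp add: group_hom_def group_hom_axioms_def)
  interpret Q: group_hom H V q using groups q by (simp add: group_hom_def group_hom_axioms_def)
  define P where "P A = the_elem (p ` A)" for A
  define Q where "Q A = the_elem (q ` A)" for A
  have P: "P \<in> iso (G Mod group_center G) V"
    using P.FactGroup_iso_set p unfolding P_def by simp
  have Q: "Q \<in> iso (H Mod group_center H) V"
    using Q.FactGroup_iso_set q unfolding Q_def by simp
  have "p ` (group_center G #>\<^bsub>G\<^esub> g) = {p g}" if "g \<in> carrier G" for g
    using that p(3) P.one_closed by (force simp: r_coset_def kernel_def p(3)[symmetric])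
  then have Pg: "P (group_center G #>\<^bsub>G\<^esub> g) = p g" if "g \<in> carrier G" for g
    using that by (simp add: P_def)
  have "q ` (group_center H #>\<^bsub>H\<^esub> g) = {q g}" if "g \<in> carrier H" for g
    using that q(3) Q.one_closed by (force simp: r_coset_def kernel_def q(3)[symmetric])
  then have Qg: "Q (group_center H #>\<^bsub>H\<^esub> g) = q g" if "g \<in> carrier H" for g
    using that by (simp add: Q_def)
  define \<theta> where "\<theta> = inv_into (carrier (H Mod group_center H)) Q \<circ> P"
  have "group (H Mod group_center H)"
    using normal.factorgroup_is_group group.group_center_normal groups(2) by blast
  then have "\<theta> \<in> iso (G Mod group_center G) (H Mod group_center H)"
    unfolding \<theta>_def using P Q group.iso_set_sym iso_set_trans by blast
  moreover have "p g = q h" if "\<theta> (group_center G #>\<^bsub>G\<^esub> g) = group_center H #>\<^bsub>H\<^esub> h"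
    and "g \<in> carrier G" "h \<in> carrier H" for g h
  proof -
    have "p g \<in> Q ` carrier (H Mod group_center H)"
      using that Q p(2) by (auto simp: iso_def bij_betw_def)
    then have "Q (\<theta> (group_center G #>\<^bsub>G\<^esub> g)) = p g"
      using f_inv_into_f[of "p g" Q] Pg[OF that(2)] by (simp add: \<theta>_def)
    then show ?thesis using that Qg by simp
  qed
  ultimately show ?thesis
    unfolding isoclinic_def
    by (intro bexI[of _ \<theta>] bexI[of _ \<phi>] ballI impI comm phi)
qed

text \<open>Both isomorphisms are composed; since the commutator condition speaks of elements, the
  intermediate cosets need representatives in \<open>H\<close>.\<close>

lemma isoclinic_trans:
  fixes G :: "('a, 'b) monoid_scheme" and H :: "('c, 'd) monoid_scheme"
    and K :: "('e, 'f) monoid_scheme"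
  assumes "isoclinic G H" "isoclinic H K"
  shows "isoclinic G K"
proof -
  obtain \<theta> \<phi> where 1: "\<theta> \<in> iso (G Mod group_center G) (H Mod group_center H)"
      "\<phi> \<in> iso (derived_subgroup G) (derived_subgroup H)"
    and c1: "\<And>g1 g2 h1 h2. \<lbrakk>g1 \<in> carrier G; g2 \<in> carrier G; h1 \<in> carrier H; h2 \<in> carrier H;
        \<theta> (group_center G #>\<^bsub>G\<^esub> g1) = group_center H #>\<^bsub>H\<^esub> h1;
        \<theta> (group_center G #>\<^bsub>G\<^esub> g2) = group_center H #>\<^bsub>H\<^esub> h2\<rbrakk>
        \<Longrightarrow> \<phi> (commutator G g1 g2) = commutator H h1 h2"
    using assms(1) unfolding isoclinic_def by blast
  obtain \<theta>' \<phi>' where 2: "\<theta>' \<in> iso (H Mod group_center H) (K Mod group_center K)"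
      "\<phi>' \<in> iso (derived_subgroup H) (derived_subgroup K)"
    and c2: "\<And>g1 g2 h1 h2. \<lbrakk>g1 \<in> carrier H; g2 \<in> carrier H; h1 \<in> carrier K; h2 \<in> carrier K;
        \<theta>' (group_center H #>\<^bsub>H\<^esub> g1) = group_center K #>\<^bsub>K\<^esub> h1;
        \<theta>' (group_center H #>\<^bsub>H\<^esub> g2) = group_center K #>\<^bsub>K\<^esub> h2\<rbrakk>
        \<Longrightarrow> \<phi>' (commutator H g1 g2) = commutator K h1 h2"
    using assms(2) unfolding isoclinic_def by blast
  have ex: "\<exists>h\<in>carrier H. \<theta> (group_center G #>\<^bsub>G\<^esub> g) = group_center H #>\<^bsub>H\<^esub> h"
    if "g \<in> carrier G" for g
  proof -
    have "\<theta> (group_center G #>\<^bsub>G\<^esub> g) \<in> carrier (H Mod group_center H)"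
      using 1(1) that by (auto simp: iso_def hom_def carrier_FactGroup)
    then show ?thesis by (auto simp: carrier_FactGroup)
  qed
  have "(\<phi>' \<circ> \<phi>) (commutator G g1 g2) = commutator K k1 k2"
    if "g1 \<in> carrier G" "g2 \<in> carrier G" "k1 \<in> carrier K" "k2 \<in> carrier K"
      "(\<theta>' \<circ> \<theta>) (group_center G #>\<^bsub>G\<^esub> g1) = group_center K #>\<^bsub>K\<^esub> k1"
      "(\<theta>' \<circ> \<theta>) (group_center G #>\<^bsub>G\<^esub> g2) = group_center K #>\<^bsub>K\<^esub> k2" for g1 g2 k1 k2
    using ex[OF that(1)] ex[OF that(2)] that c1[OF that(1,2)] c2[OF _ _ that(3,4)] by auto
  with iso_set_trans[OF 1(1) 2(1)] iso_set_trans[OF 1(2) 2(2)] show ?thesis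
    unfolding isoclinic_def by blast
qed

lemma hom_commutator:
  assumes "group_hom G H f" "x \<in> carrier G" "y \<in> carrier G"
  shows "f (commutator G x y) = commutator H (f x) (f y)"
proof -
  interpret group_hom G H f by fact
  show ?thesis using assms by (simp add: commutator_def)
qed

lemma iso_derived_subgroup:
  assumes "group G" "group H" and f: "f \<in> iso G H"
  shows "f \<in> iso (derived_subgroup G) (derived_subgroup H)"
proof -
  interpret group_hom G H f
    using assms by (simp add: group_hom_def group_hom_axioms_def iso_def)
  have surj: "carrier H = f ` carrier G" and inj: "inj_on f (carrier G)"
    using f by (auto simp: iso_def bij_betw_def)
  have "f ` derived G (carrier G) = derived H (carrier H)"
    using derived_img[of "carrier G"] surj by simp
  then show ?thesis
    using G.derived_in_carrier[of "carrier G"] inj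
    by (auto simp: iso_def hom_def derived_subgroup_def bij_betw_def subset_iff
        intro: inj_on_subset)
qed

lemma iso_group_center:
  assumes "group G" "group H" and f: "f \<in> iso G H"
  shows "f -` group_center H \<inter> carrier G = group_center G"
proof -
  have f': "f ` carrier G = carrier H" "inj_on f (carrier G)"
    "\<And>x y. x \<in> carrier G \<Longrightarrow> y \<in> carrier G \<Longrightarrow> f (x \<otimes>\<^bsub>G\<^esub> y) = f x \<otimes>\<^bsub>H\<^esub> f y"
    using f by (auto simp: iso_def bij_betw_def hom_def)
  have "f x \<in> group_center H \<longleftrightarrow> x \<in> group_center G" if x: "x \<in> carrier G" for x
  proof -
    have "f x \<in> group_center H \<longleftrightarrow> (\<forall>y\<in>carrier G. f x \<otimes>\<^bsub>H\<^esub> f y = f y \<otimes>\<^bsub>H\<^esub> f x)"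
      using x by (auto simp: group_center_def f'(1)[symmetric])
    also have "\<dots> \<longleftrightarrow> (\<forall>y\<in>carrier G. x \<otimes>\<^bsub>G\<^esub> y = y \<otimes>\<^bsub>G\<^esub> x)"
      using x f'(3) inj_onD[OF f'(2)] assms(1) by (metis group.is_monoid monoid.m_closed)
    finally show ?thesis using x by (simp add: group_center_def)
  qed
  then show ?thesis by (auto simp: group_center_def)
qed

text \<open>The common quotient is \<open>H\<close> modulo its center. Equal images determine
  \<open>f g\<close> and \<open>h\<close> only up to the center, which commutators do not
  see.\<close>

lemma isoclinic_of_iso:
  assumes groups: "group G" "group H" and f: "f \<in> iso G H"
  shows "isoclinic G H"
proof -
  interpret group_hom G H f
    using assms by (simp add: group_hom_def group_hom_axioms_def iso_def)
  let ?q = "\<lambda>h. group_center H #>\<^bsub>H\<^esub> h"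
  interpret Z: normal "group_center H" H by (rule H.group_center_normal)
  have surj: "f ` carrier G = carrier H" using f by (auto simp: iso_def bij_betw_def)
  have qf: "?q (f g) = group_center H \<longleftrightarrow> g \<in> group_center G" if "g \<in> carrier G" for g
    using H.r_coset_eq_self_iff[OF H.subgroup_group_center] that iso_group_center[OF assms] by auto
  show ?thesis
  proof (rule isoclinicI[OF groups Z.factorgroup_is_group])
    show "?q \<in> hom H (H Mod group_center H)" by (rule Z.r_coset_hom_Mod)
    then show "?q \<circ> f \<in> hom G (H Mod group_center H)" by (rule Group.hom_compose[OF homh])
    show "(?q \<circ> f) ` carrier G = carrier (H Mod group_center H)"
      "?q ` carrier H = carrier (H Mod group_center H)"
      by (simp_all add: carrier_FactGroup surj[symmetric] image_image)
    show "kernel G (H Mod group_center H) (?q \<circ> f) = group_center G"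
      using qf G.group_center_subset by (auto simp: kernel_def)
    show "kernel H (H Mod group_center H) ?q = group_center H"
      using H.r_coset_eq_self_iff[OF H.subgroup_group_center] H.group_center_subset
      by (auto simp: kernel_def)
    show "f \<in> iso (derived_subgroup G) (derived_subgroup H)"
      using assms by (rule iso_derived_subgroup)
    fix g1 g2 h1 h2
    assume g: "g1 \<in> carrier G" "g2 \<in> carrier G" and h: "h1 \<in> carrier H" "h2 \<in> carrier H"
      and eq: "(?q \<circ> f) g1 = ?q h1" "(?q \<circ> f) g2 = ?q h2"
    then have "commutator H (f g1) (f g2) = commutator H h1 h2"
      by (intro H.commutator_r_coset) auto
    then show "f (commutator G g1 g2) = commutator H h1 h2"
      using hom_commutator[OF group_hom_axioms] g by simp
  qed
qed

text \<open>Members of \<open>isoclinism_family\<close> have natural numbers as elements, so groups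
  on other types must be copied. The multiplication is transported along an injection, regarded as a
  weak morphism with trivial kernel.\<close>

lemma exists_nat_monoid_iso:
  assumes G: "group G" "finite (carrier G)"
  obtains H :: "nat monoid" and f where "group H" "f \<in> iso G H"
proof -
  obtain f :: "'a \<Rightarrow> nat" where inj: "inj_on f (carrier G)"
    using finite_imp_inj_to_nat_seg[OF G(2)] by blast
  interpret group G by fact
  have "f a = f b \<longleftrightarrow> a \<otimes>\<^bsub>G\<^esub> inv\<^bsub>G\<^esub> b \<in> {\<one>\<^bsub>G\<^esub>}" if "a \<in> carrier G" "b \<in> carrier G" for a b
    using that inj_on_eq_iff[OF inj] r_coset_eq_iff[OF triv_subgroup, of a b]
      inv_solve_right[of "\<one>\<^bsub>G\<^esub>" a b] by auto
  then have weak: "weak_group_morphism f {\<one>\<^bsub>G\<^esub>} G"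
    by (intro weak_group_morphismsI one_is_normal)
  have "f \<in> iso G (image_group f G)"
    using weak_group_morphism_is_hom[OF weak] inj
    by (simp add: iso_iff image_group_carrier)
  with image_group_is_group[OF weak] show thesis by (rule that)
qed

section \<open>Orders of members and the rank of a family\<close>

lemma iso_order_eq: "f \<in> iso G H \<Longrightarrow> order G = order H"
  by (auto simp: iso_def order_def bij_betw_same_card)

lemma isoclinism_family_realizes_order:
  assumes "group K" "finite (carrier K)" "isoclinic G K"
  shows "\<exists>H\<in>isoclinism_family G. order H = order K"
proof -
  obtain H :: "nat monoid" and f where H: "group H" "f \<in> iso K H"
    using exists_nat_monoid_iso assms by blast
  then have "isoclinic G H" using assms isoclinic_of_iso isoclinic_trans by blast
  moreover have "finite (carrier H)"
    using H(2) assms(2) bij_betw_finite by (auto simp: iso_def)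
  moreover have "order H = order K" using H iso_order_eq by metis
  ultimately show ?thesis using H by (auto simp: isoclinism_family_def)
qed

lemma family_rank_le:
  assumes "group K" "order K = 2 ^ r" "isoclinic G K"
  shows "family_rank G \<le> r"
proof -
  \<comment> \<open>An infinite carrier has order 0, which is not a power of 2.\<close>
  have "finite (carrier K)" using assms(2) by (intro card_ge_0_finite) (simp add: order_def)
  then show ?thesis unfolding family_rank_def
    using isoclinism_family_realizes_order[OF assms(1) _ assms(3)] assms(2) by (intro Least_le) simp
qed

lemma family_rank_attained:
  assumes "group G" "order G = 2 ^ m"
  obtains H where "H \<in> isoclinism_family G" "order H = 2 ^ family_rank G"
proof -
  have "finite (carrier G)" using assms(2) by (intro card_ge_0_finite) (simp add: order_def)
  moreover have "isoclinic G G" using assms isoclinic_of_iso iso_set_refl by blast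
  ultimately have "\<exists>H\<in>isoclinism_family G. order H = 2 ^ m"
    using isoclinism_family_realizes_order[OF assms(1)] assms(2) by metis
  then have "\<exists>H\<in>isoclinism_family G. order H = 2 ^ family_rank G"
    unfolding family_rank_def by (rule LeastI)
  then show thesis using that by blast
qed

section \<open>Small representatives: the dihedral group of order eight and the trivial
  group\<close>

text \<open>The dihedral group of order 8, as the central extension of the four-group by the cocycle
  \<open>((i, j), (i', j')) \<mapsto> i \<and> j'\<close>.\<close>

definition dihedral_eight :: "(bool \<times> bool \<times> bool) monoid" where
  "dihedral_eight = \<lparr>carrier = UNIV,
     monoid.mult = (\<lambda>(i, j, s) (k, l, t). (i \<noteq> k, j \<noteq> l, (s \<noteq> t) \<noteq> (i \<and> l))),
     one = (False, False, False)\<rparr>"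

lemma group_dihedral_eight: "group dihedral_eight"
proof (rule groupI)
  fix x assume "x \<in> carrier dihedral_eight"
  obtain i j s where "x = (i, j, s)" by (cases x)
  \<comment> \<open>The product picks up the cocycle value \<open>i \<and> j\<close>, which the last
    entry of the left inverse cancels.\<close>
  then have "(i, j, s \<noteq> (i \<and> j)) \<otimes>\<^bsub>dihedral_eight\<^esub> x = \<one>\<^bsub>dihedral_eight\<^esub>"
    by (auto simp: dihedral_eight_def)
  then show "\<exists>y\<in>carrier dihedral_eight. y \<otimes>\<^bsub>dihedral_eight\<^esub> x = \<one>\<^bsub>dihedral_eight\<^esub>"
    by (auto simp: dihedral_eight_def)
qed (auto simp: dihedral_eight_def)

lemma order_dihedral_eight: "order dihedral_eight = 8"
  by (simp add: order_def dihedral_eight_def UNIV_Times_UNIV[symmetric] card_cartesian_product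
      del: UNIV_Times_UNIV)

lemma group_center_dihedral_eight:
  "group_center dihedral_eight = {(False, False, False), (False, False, True)}"
  by (simp add: set_eq_iff group_center_def dihedral_eight_def all_bool_eq)

text \<open>The four-group is the common quotient, and both derived subgroups have order 2, so
  \<phi> can only match their nontrivial elements. As every commutator is trivial or that element,
  the commutator condition reduces to equality of the commutation patterns.\<close>

lemma isoclinic_center_index_four:
  fixes G :: "('a, 'b) monoid_scheme" and H :: "('c, 'd) monoid_scheme"
  assumes "center_index_four G" "center_index_four H"
  shows "isoclinic G H"
proof -
  interpret G: center_index_four G by fact
  interpret H: center_index_four H by fact
  obtain a b where ab: "a \<in> carrier G" "b \<in> carrier G" "a \<otimes>\<^bsub>G\<^esub> b \<noteq> b \<otimes>\<^bsub>G\<^esub> a"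
    by (rule G.exists_noncommuting)
  obtain a' b' where ab': "a' \<in> carrier H" "b' \<in> carrier H" "a' \<otimes>\<^bsub>H\<^esub> b' \<noteq> b' \<otimes>\<^bsub>H\<^esub> a'"
    by (rule H.exists_noncommuting)
  obtain p where p: "p \<in> hom G klein_four" "p ` carrier G = UNIV"
    "kernel G klein_four p = group_center G" by (rule G.exists_hom_klein_four)
  obtain q where q: "q \<in> hom H klein_four" "q ` carrier H = UNIV"
    "kernel H klein_four q = group_center H" by (rule H.exists_hom_klein_four)
  define c where "c = commutator G a b"
  define c' where "c' = commutator H a' b'"
  have c: "c \<in> carrier G" "c \<noteq> \<one>\<^bsub>G\<^esub>" "c \<otimes>\<^bsub>G\<^esub> c = \<one>\<^bsub>G\<^esub>"
    using G.commutator_closed G.commutator_eq_one_iff G.commutator_involution ab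
    by (auto simp: c_def)
  have c': "c' \<in> carrier H" "c' \<noteq> \<one>\<^bsub>H\<^esub>" "c' \<otimes>\<^bsub>H\<^esub> c' = \<one>\<^bsub>H\<^esub>"
    using H.commutator_closed H.commutator_eq_one_iff H.commutator_involution ab'
    by (auto simp: c'_def)
  define \<phi> where "\<phi> x = (if x = c then c' else \<one>\<^bsub>H\<^esub>)" for x
  have der: "carrier (derived_subgroup G) = {\<one>\<^bsub>G\<^esub>, c}" "carrier (derived_subgroup H) = {\<one>\<^bsub>H\<^esub>, c'}"
    using G.derived_eq[OF ab] H.derived_eq[OF ab']
    by (simp_all add: derived_subgroup_def c_def c'_def)
  show ?thesis
  proof (rule isoclinicI[OF G.is_group H.is_group group_klein_four])
    show "p ` carrier G = carrier klein_four" "q ` carrier H = carrier klein_four"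
      using p q by (simp_all add: klein_four_def)
    have "\<phi> \<in> hom (derived_subgroup G) (derived_subgroup H)"
      using c c' der by (auto simp: hom_def \<phi>_def derived_subgroup_def)
    moreover have "bij_betw \<phi> (carrier (derived_subgroup G)) (carrier (derived_subgroup H))"
      using c c' der by (auto simp: bij_betw_def \<phi>_def)
    ultimately show "\<phi> \<in> iso (derived_subgroup G) (derived_subgroup H)" by (rule isoI)
    fix g1 g2 h1 h2
    assume g: "g1 \<in> carrier G" "g2 \<in> carrier G" and h: "h1 \<in> carrier H" "h2 \<in> carrier H"
      and eq: "p g1 = q h1" "p g2 = q h2"
    have "g1 \<otimes>\<^bsub>G\<^esub> g2 = g2 \<otimes>\<^bsub>G\<^esub> g1 \<longleftrightarrow> h1 \<otimes>\<^bsub>H\<^esub> h2 = h2 \<otimes>\<^bsub>H\<^esub> h1"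
      using G.commute_iff_hom[OF p(1,3) g] H.commute_iff_hom[OF q(1,3) h] eq by simp
    then show "\<phi> (commutator G g1 g2) = commutator H h1 h2"
      using G.commutator_eq_of_noncommuting[OF g _ ab] H.commutator_eq_of_noncommuting[OF h _ ab']
        G.commutator_eq_one_iff[OF g] H.commutator_eq_one_iff[OF h] c
      by (auto simp: \<phi>_def c_def[symmetric] c'_def[symmetric])
  qed (use p q in auto)
qed

lemma center_index_four_dihedral_eight: "center_index_four dihedral_eight"
proof -
  interpret group dihedral_eight by (rule group_dihedral_eight)
  show ?thesis
  proof unfold_locales
    show "finite (carrier dihedral_eight)" by (simp add: dihedral_eight_def)
    show "order dihedral_eight = 4 * card (group_center dihedral_eight)"
      by (simp add: order_dihedral_eight group_center_dihedral_eight)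
  qed
qed

lemma isoclinic_trivial:
  fixes G :: "('a, 'b) monoid_scheme"
  assumes G: "group G" and comm: "group_center G = carrier G"
  defines "E \<equiv> \<lparr>carrier = {()}, monoid.mult = (\<lambda>_ _. ()), one = ()\<rparr>"
  shows "group E" "order E = 1" "isoclinic G E"
proof -
  show E: "group E" by (rule groupI) (auto simp: E_def)
  show "order E = 1" by (simp add: order_def E_def)
  interpret G: group G by fact
  interpret E: group E by fact
  have c: "commutator G x y = \<one>\<^bsub>G\<^esub>" if "x \<in> carrier G" "y \<in> carrier G" for x y
    using that comm G.commutator_eq_one_iff by (auto simp: group_center_def)
  have "derived G (carrier G) \<subseteq> {\<one>\<^bsub>G\<^esub>}"
    unfolding G.derived_eq_generate_commutators
    using c by (intro G.generate_subgroup_incl G.triv_subgroup) auto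
  then have dG: "derived G (carrier G) = {\<one>\<^bsub>G\<^esub>}"
    using subgroup.one_closed[OF G.derived_is_subgroup[of "carrier G"]] by auto
  have dE: "derived E (carrier E) = {()}"
    using subgroup.one_closed[OF E.derived_is_subgroup[of "carrier E"]] by auto
  show "isoclinic G E"
  proof (rule isoclinicI[OF G E E])
    show "(\<lambda>_. ()) \<in> iso (derived_subgroup G) (derived_subgroup E)"
      using dG dE by (auto simp: derived_subgroup_def iso_def hom_def bij_betw_def)
    show "(\<lambda>_. ()) ` carrier G = carrier E" by (auto simp: E_def)
    show "kernel G E (\<lambda>_. ()) = group_center G" using comm by (auto simp: kernel_def)
    show "kernel E E id = group_center E" by (auto simp: kernel_def group_center_def E_def)
  qed (auto simp: hom_def E_def)
qed

section \<open>Groups of order 16 with center of order 2\<close>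

text \<open>The commutation pattern of the dihedral, semidihedral and quaternion groups of order 16,
  expressed on the cosets of the center, so that it only depends on the isoclinism family:
  \<open>\<Union>S\<close> is the abelian subgroup of index 2, and outside of it an element commutes only with
  its own coset and the center.\<close>

locale dihedral_commutation = group +
  fixes S :: "'a set set"
  assumes finite_carrier: "finite (carrier G)"
    and order_eq: "order G = 8 * card (group_center G)"
    and S_subset: "S \<subseteq> rcosets (group_center G)"
    and center_mem: "group_center G \<in> S"
    and card_S: "card S = 4"
    and commute_iff: "\<And>x y. \<lbrakk>x \<in> carrier G; y \<in> carrier G\<rbrakk> \<Longrightarrow> x \<otimes> y = y \<otimes> x \<longleftrightarrow>
      group_center G #> x \<in> S \<and> group_center G #> y \<in> S \<or> group_center G #> x = group_center G \<or>
      group_center G #> y = group_center G \<or> group_center G #> x = group_center G #> y"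

section \<open>The class equation and centralizers of index two\<close>

context group
begin

text \<open>The noncentral elements are a union of conjugacy classes, and the class of
  \<open>x\<close> has |G| divided by \<open>card (centralizer G x)\<close> elements, a multiple of
  \<open>k\<close> by assumption.\<close>

lemma dvd_card_noncentral:
  assumes fin: "finite (carrier G)"
    and dvd: "\<And>x. \<lbrakk>x \<in> carrier G; x \<notin> group_center G\<rbrakk> \<Longrightarrow> k * card (centralizer G x) dvd order G"
  shows "k dvd card (carrier G - group_center G)"
proof -
  define f where "f = (\<lambda>g. \<lambda>h\<in>carrier G. g \<otimes> h \<otimes> inv g)"
  interpret act: group_action G "carrier G" f
    unfolding f_def by (rule action_by_conjugation)
  have stab: "stabilizer G f x = centralizer G x" if "x \<in> carrier G" for x
    using that conj_eq_iff_mem_centralizer mem_centralizer_sym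
    by (auto simp: stabilizer_def f_def centralizer_def)
  let ?T = "carrier G - group_center G"
  have orbit: "orbit G f x \<subseteq> ?T" if x: "x \<in> ?T" for x
  proof
    fix y assume y: "y \<in> orbit G f x"
    have yc: "y \<in> carrier G" using y x act.element_image[of _ x y] by (auto simp: orbit_def)
    then have "x \<in> orbit G f y" using act.orbit_sym x y by blast
    then obtain g where g: "g \<in> carrier G" "x = g \<otimes> y \<otimes> inv g" using yc by (auto simp: orbit_def f_def)
    have "y \<notin> group_center G"
    proof
      assume yZ: "y \<in> group_center G"
      then have "y \<in> centralizer G g" using g group_center_subset_centralizer by blast
      then have "x = y" using conj_eq_iff_mem_centralizer g yc by simp
      then show False using yZ x by simp
    qed
    then show "y \<in> ?T" using yc by simp
  qed
  define C where "C = orbit G f ` ?T"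
  have U: "\<Union>C = ?T" unfolding C_def using orbit act.orbit_refl by blast
  have "k dvd card (\<Union>C)"
  proof (rule dvd_partition)
    show "finite (\<Union>C)" using U fin by simp
    have "k dvd card (orbit G f x)" if x: "x \<in> ?T" for x
    proof -
      have "card (orbit G f x) * card (centralizer G x) = order G"
        using act.orbit_stabilizer_theorem[of x] x stab by simp
      moreover have "card (centralizer G x) \<noteq> 0"
        using calculation fin order_gt_0_iff_finite by (metis mult_0_right less_irrefl)
      ultimately show ?thesis
        using dvd[of x] x by (metis DiffE dvd_times_right_cancel_iff mult.commute)
    qed
    then show "\<forall>c\<in>C. k dvd card c" by (auto simp: C_def)
    have "C \<subseteq> orbits G (carrier G) f" by (auto simp: C_def orbits_def)
    then show "\<forall>c1\<in>C. \<forall>c2\<in>C. c1 \<noteq> c2 \<longrightarrow> c1 \<inter> c2 = {}"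
      using act.disjoint_union by blast
  qed
  then show ?thesis using U by simp
qed

lemma dihedral_commutation_of_centralizer:
  assumes fin: "finite (carrier G)" and ord: "order G = 8 * card (group_center G)"
    and g: "g \<in> carrier G" and cg: "order G = 2 * card (centralizer G g)"
  shows "\<exists>S. dihedral_commutation G S"
proof -
  let ?Z = "group_center G"
  define A where "A = centralizer G g"
  have Z: "subgroup ?Z G" by (rule subgroup_group_center)
  have A: "subgroup A G" unfolding A_def using g by (rule subgroup_centralizer)
  have finite_sub: "finite B" if "B \<subseteq> carrier G" for B using that fin finite_subset by blast
  have zpos: "card ?Z > 0" using fin ord order_gt_0_iff_finite by simp
  have cA: "card A = 4 * card ?Z" using cg ord by (simp add: A_def)
  have ZA: "?Z \<subseteq> A" unfolding A_def using g by (rule group_center_subset_centralizer)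
  have Ac: "A \<subseteq> carrier G" using A by (rule subgroup.subset)
  have gZ: "g \<notin> ?Z" using cA ord zpos centralizer_eq_carrier_iff[OF g] by (auto simp: A_def order_def)
  have Zg: "?Z \<union> (?Z #> g) \<subseteq> A"
    unfolding A_def using g group_center_subset_centralizer r_coset_subset_centralizer by simp
  have cZg: "card (?Z \<union> (?Z #> g)) = 2 * card ?Z"
    using g gZ r_coset_eq_self_iff[OF Z] by (intro card_center_Un_coset fin) (auto simp: RCOSETS_def)
  \<comment> \<open>\<open>A\<close> is abelian. Suppose \<open>u\<close> fails to commute with all
    of \<open>A\<close>. Its centralizer in \<open>A\<close> is then proper but contains the center
    and the coset of \<open>g\<close>; between 2 and 4 cosets, by divisibility, this leaves exactly
    these two. As \<open>u\<close> itself belongs to it, \<open>u\<close> is central or a central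
    multiple of \<open>g\<close>, and so commutes with \<open>A\<close> after all.\<close>
  have comm: "A \<subseteq> centralizer G u" if u: "u \<in> A" for u
  proof (rule ccontr)
    assume *: "\<not> A \<subseteq> centralizer G u"
    have uc: "u \<in> carrier G" using u Ac by blast
    let ?I = "centralizer G u \<inter> A"
    have I: "subgroup ?I G" using subgroup_centralizer[OF uc] A by (rule subgroups_Inter_pair)
    have gu: "g \<in> centralizer G u" using u g uc by (auto simp: A_def centralizer_def)
    have ZI: "?Z \<union> (?Z #> g) \<subseteq> ?I"
      using Zg group_center_subset_centralizer[OF uc] gu subgroup.m_closed[OF subgroup_centralizer[OF uc]]
      by (auto simp: r_coset_def)
    obtain j where j: "card ?I = j * card ?Z"
      using subgroup_card_dvd[OF Z I] ZI by (metis Un_subset_iff dvd_def mult.commute)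
    have "card ?I dvd card A" using I A by (intro subgroup_card_dvd) auto
    then have "j dvd 4" using j cA zpos by simp
    moreover have "card ?I < card A" using * Ac finite_sub by (intro psubset_card_mono) auto
    moreover have "2 * card ?Z \<le> card ?I"
      using card_mono[OF _ ZI] cZg finite_sub[of ?I] Ac by auto
    ultimately have "j dvd 4" "j < 4" "2 \<le> j" using j cA zpos by auto
    moreover have "j \<noteq> 3" using \<open>j dvd 4\<close> by (intro notI) simp
    ultimately have "j = 2" by simp
    then have "?I = ?Z \<union> (?Z #> g)"
      using ZI cZg j Ac finite_sub by (intro card_subset_eq[symmetric]) auto
    then have "u \<in> ?Z \<or> u \<in> ?Z #> g" using u centralizer_self[OF uc] by auto
    then show False
    proof
      assume "u \<in> ?Z"
      then show False using * Ac centralizer_eq_carrier_iff[OF uc] by blast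
    next
      assume "u \<in> ?Z #> g"
      then have "?Z #> g = ?Z #> u" using repr_independence g Z by blast
      then have "centralizer G u = A" using centralizer_r_coset g uc unfolding A_def by blast
      then show False using * by simp
    qed
  qed
  \<comment> \<open>The centralizer contains \<open>A\<close>, which is 4 cosets of the center, and
    the only divisor of 8 from 4 to 7 is 4.\<close>
  have cent: "centralizer G u = A" if u: "u \<in> A" "u \<notin> ?Z" for u
  proof (rule card_subset_eq[symmetric])
    have uc: "u \<in> carrier G" using u Ac by blast
    show "finite (centralizer G u)" by (rule finite_sub) (auto simp: centralizer_def)
    show "A \<subseteq> centralizer G u" using comm u by blast
    then have le: "card A \<le> card (centralizer G u)"
      using \<open>finite (centralizer G u)\<close> by (rule card_mono[rotated])
    obtain k where k: "card (centralizer G u) = k * card ?Z" "k dvd 8" "1 < k" "k < 8"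
      using group_center_index_noncentral[OF fin ord uc u(2)] .
    have "k \<noteq> 5" "k \<noteq> 6" "k \<noteq> 7" using k(2) by (intro notI; simp)+
    moreover have "4 \<le> k" using le cA k zpos by simp
    ultimately have "k = 4" using k(4) by simp
    then show "card A = card (centralizer G u)" using k cA by simp
  qed
  \<comment> \<open>A noncentral element of \<open>A\<close> has centralizer \<open>A\<close>, so it
    does not commute with \<open>x\<close>. If \<open>y\<close> also lies outside \<open>A\<close>,
    then \<open>x \<otimes> inv y\<close> lies in \<open>A\<close> and commutes with
    \<open>x\<close>, hence is central.\<close>
  have out: "y \<in> ?Z \<or> ?Z #> x = ?Z #> y"
    if x: "x \<in> carrier G" "x \<notin> A" and y: "y \<in> centralizer G x" for x y
  proof -
    have yc: "y \<in> carrier G" using y by (simp add: centralizer_def)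
    have inter: "w \<in> ?Z" if "w \<in> A" "w \<in> centralizer G x" for w
      using cent[of w] that x mem_centralizer_sym Ac by blast
    show ?thesis
    proof (cases "y \<in> A")
      case True
      then show ?thesis using inter y by blast
    next
      case False
      have iy: "inv y \<notin> A" using False A yc subgroup.m_inv_closed by (metis inv_inv)
      have "x \<otimes> inv y \<in> A"
        using index_two_mult_mem_iff[OF A _ fin x(1), of "inv y"] cg x iy yc by (simp add: A_def)
      moreover have "x \<otimes> inv y \<in> centralizer G x"
        using subgroup_centralizer[OF x(1)] y centralizer_self[OF x(1)]
        by (simp add: subgroup.m_closed subgroup.m_inv_closed)
      ultimately show ?thesis using inter r_coset_eq_iff[OF Z] x yc by blast
    qed
  qed
  define S where "S = {R \<in> rcosets ?Z. R \<subseteq> A}"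
  have S_iff: "?Z #> x \<in> S \<longleftrightarrow> x \<in> A" if x: "x \<in> carrier G" for x
  proof
    assume "?Z #> x \<in> S"
    then show "x \<in> A" using rcos_self[OF x Z] by (auto simp: S_def)
  next
    assume "x \<in> A"
    then have "?Z #> x \<subseteq> A" using ZA subgroup.m_closed[OF A] by (auto simp: r_coset_def)
    then show "?Z #> x \<in> S" using x by (auto simp: S_def RCOSETS_def)
  qed
  have "\<Union>S = A"
  proof
    show "\<Union>S \<subseteq> A" by (auto simp: S_def)
    show "A \<subseteq> \<Union>S" using S_iff Ac rcos_self[OF _ Z] by blast
  qed
  then have "card ?Z * card S = card A"
    using card_Union_rcosets[OF Z fin, of S] by (auto simp: S_def)
  then have "card S = 4" using cA zpos by simp
  have "dihedral_commutation G S"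
  proof unfold_locales
    show "S \<subseteq> rcosets ?Z" by (auto simp: S_def)
    show "?Z \<in> S" using ZA subgroup.subgroup_in_rcosets[OF Z is_group] by (simp add: S_def)
    fix x y assume xy: "x \<in> carrier G" "y \<in> carrier G"
    have self: "?Z #> x = ?Z \<longleftrightarrow> x \<in> ?Z" "?Z #> y = ?Z \<longleftrightarrow> y \<in> ?Z"
      using xy r_coset_eq_self_iff[OF Z] by auto
    have "x \<otimes> y = y \<otimes> x \<longleftrightarrow> y \<in> centralizer G x" using xy by (simp add: centralizer_def)
    also have "\<dots> \<longleftrightarrow> x \<in> A \<and> y \<in> A \<or> x \<in> ?Z \<or> y \<in> ?Z \<or> ?Z #> x = ?Z #> y"
      using out[of x y] out[of y x] comm[of x] mem_centralizer_sym[OF xy] xy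
        centralizer_r_coset[OF xy] centralizer_self group_center_subset_centralizer by blast
    finally show "x \<otimes> y = y \<otimes> x \<longleftrightarrow> ?Z #> x \<in> S \<and> ?Z #> y \<in> S \<or> ?Z #> x = ?Z \<or>
      ?Z #> y = ?Z \<or> ?Z #> x = ?Z #> y"
      using S_iff xy self by simp
  qed fact+
  then show ?thesis by blast
qed

end

lemma dvd_sixteen_nat: "d dvd (16::nat) \<Longrightarrow> d \<in> {1, 2, 4, 8, 16}"
proof -
  assume "d dvd 16"
  then have "d dvd 2 ^ 4" by simp
  then obtain i where "i \<le> 4" "d = 2 ^ i" using divides_primepow_nat two_is_prime_nat by blast
  then show ?thesis by (auto simp: le_Suc_eq numeral_eq_Suc)
qed

text \<open>Only a center of order 2 survives: order 1 contradicts the class equation, order 4 is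
  excluded by hypothesis, and order 8 would leave no room for a centralizer strictly between the
  center and the group.\<close>

lemma dihedral_commutation_order_sixteen:
  assumes G: "group G" and ord: "order G = 16"
    and abelian: "group_center G \<noteq> carrier G" and four: "\<not> center_index_four G"
  shows "\<exists>S. dihedral_commutation G S"
proof -
  interpret group G by fact
  let ?z = "card (group_center G)"
  have fin: "finite (carrier G)" using ord by (intro card_ge_0_finite) (simp add: order_def)
  have card_diff: "card (carrier G - group_center G) = 16 - ?z"
    using ord group_center_subset fin by (simp add: card_Diff_subset finite_subset order_def)
  obtain x where x: "x \<in> carrier G" "x \<notin> group_center G"
    using abelian group_center_subset by blast
  have "?z \<in> {1, 2, 4, 8, 16}"
    using card_subgroup_dvd_order[OF subgroup_group_center] ord dvd_sixteen_nat by simp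
  moreover have "?z \<noteq> 16"
    using card_subset_eq[OF fin group_center_subset] abelian ord by (auto simp: order_def)
  moreover have "?z \<noteq> 4"
    using four fin ord G by (auto simp: center_index_four_def center_index_four_axioms_def)
  moreover have "?z \<noteq> 8"
  proof
    assume "?z = 8"
    then have o: "order G = 2 * ?z" using ord by simp
    obtain k where "1 < k" "k < (2::nat)" using group_center_index_noncentral[OF fin o x] by metis
    then show False by simp
  qed
  moreover have "?z \<noteq> 1"
  proof
    assume z: "?z = 1"
    \<comment> \<open>Every noncentral class would have even size, but there would be 15 noncentral
      elements.\<close>
    have "2 * card (centralizer G y) dvd order G" if y: "y \<in> carrier G" "y \<notin> group_center G" for y
    proof -
      have o: "order G = 16 * ?z" using ord z by simp
      obtain k where "card (centralizer G y) = k" "k dvd 16" "k < 16"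
        using group_center_index_noncentral[OF fin o y] z by (metis mult.right_neutral)
      then show ?thesis using dvd_sixteen_nat[of k] ord by auto
    qed
    then have "2 dvd card (carrier G - group_center G)" using fin dvd_card_noncentral by blast
    then show False using card_diff z by simp
  qed
  ultimately have z: "?z = 2" by auto
  then have ordz: "order G = 8 * ?z" using ord by simp
  have "\<exists>g\<in>carrier G. order G = 2 * card (centralizer G g)"
  proof (rule ccontr)
    assume *: "\<not> ?thesis"
    \<comment> \<open>Noncentral centralizers have order 4 or 8. Without order 8 all noncentral
      classes would have 4 elements, but 4 does not divide 14.\<close>
    have "4 * card (centralizer G y) dvd order G" if y: "y \<in> carrier G" "y \<notin> group_center G" for y
    proof -
      obtain k where k: "card (centralizer G y) = k * 2" "k dvd 8" "1 < k" "k < 8"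
        using group_center_index_noncentral[OF fin ordz y] z by metis
      have "k dvd 16" using k(2) dvd_trans[of k 8 16] by simp
      then have "k = 2 \<or> k = 4" using dvd_sixteen_nat[of k] k by auto
      then show ?thesis using * k y ord by auto
    qed
    then have "4 dvd card (carrier G - group_center G)" using fin dvd_card_noncentral by blast
    then show False using card_diff z by simp
  qed
  then show ?thesis using dihedral_commutation_of_centralizer[OF fin ordz] by blast
qed

text \<open>Two elements commute exactly when their commutator is trivial, and \<phi>, being
  injective on the derived subgroup, preserves this. So the pattern pulls back along \<theta>, with
  \<open>T\<close> the preimage of \<open>S\<close>; the index 8 of the center transfers, while the
  order of the center may change.\<close>

lemma dihedral_commutation_isoclinic:
  fixes G :: "('a, 'b) monoid_scheme" and H :: "('c, 'd) monoid_scheme"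
  assumes G: "group G" "finite (carrier G)" and iso: "isoclinic G H"
    and H: "dihedral_commutation H S"
  shows "\<exists>T. dihedral_commutation G T"
proof -
  interpret G: group G by fact
  interpret H: dihedral_commutation H S by fact
  let ?Z = "group_center G" and ?W = "group_center H"
  have Z: "subgroup ?Z G" and W: "subgroup ?W H"
    by (rule G.subgroup_group_center H.subgroup_group_center)+
  interpret ZN: normal ?Z G by (rule G.group_center_normal)
  interpret WN: normal ?W H by (rule H.group_center_normal)
  obtain \<theta> \<phi> where \<theta>: "\<theta> \<in> iso (G Mod ?Z) (H Mod ?W)"
      and \<phi>: "\<phi> \<in> iso (derived_subgroup G) (derived_subgroup H)"
    and comm: "\<And>g1 g2 h1 h2. \<lbrakk>g1 \<in> carrier G; g2 \<in> carrier G; h1 \<in> carrier H; h2 \<in> carrier H;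
        \<theta> (?Z #>\<^bsub>G\<^esub> g1) = ?W #>\<^bsub>H\<^esub> h1; \<theta> (?Z #>\<^bsub>G\<^esub> g2) = ?W #>\<^bsub>H\<^esub> h2\<rbrakk>
        \<Longrightarrow> \<phi> (commutator G g1 g2) = commutator H h1 h2"
    using iso unfolding isoclinic_def by blast
  have bij: "bij_betw \<theta> (rcosets\<^bsub>G\<^esub> ?Z) (rcosets\<^bsub>H\<^esub> ?W)"
    using \<theta> by (simp add: iso_def FactGroup_def)
  have \<theta>_one: "\<theta> ?Z = ?W"
    using hom_one[of \<theta> "G Mod ?Z" "H Mod ?W"] \<theta> ZN.factorgroup_is_group WN.factorgroup_is_group
    by (simp add: iso_def)
  have cosG: "?Z #>\<^bsub>G\<^esub> g \<in> rcosets\<^bsub>G\<^esub> ?Z" if "g \<in> carrier G" for g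
    using that by (auto simp: RCOSETS_def)
  have ZG: "?Z \<in> rcosets\<^bsub>G\<^esub> ?Z" by (rule ZN.subgroup_in_rcosets[OF G.is_group])
  define T where "T = {R \<in> rcosets\<^bsub>G\<^esub> ?Z. \<theta> R \<in> S}"
  have "dihedral_commutation G T"
  proof unfold_locales
    show "finite (carrier G)" by fact
    have "finite ?W" using H.finite_carrier H.group_center_subset finite_subset by blast
    then have "card ?W > 0" using subgroup.one_closed[OF W] by (metis card_gt_0_iff empty_iff)
    then have "card (rcosets\<^bsub>H\<^esub> ?W) = 8"
      using H.lagrange[OF W] H.order_eq by simp
    then show "order G = 8 * card ?Z"
      using G.lagrange[OF Z] bij_betw_same_card[OF bij] by simp
    show "T \<subseteq> rcosets\<^bsub>G\<^esub> ?Z" by (auto simp: T_def)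
    show "?Z \<in> T" using ZG \<theta>_one H.center_mem by (simp add: T_def)
    have "bij_betw \<theta> T S"
    proof (rule bij_betw_subset[OF bij])
      show "T \<subseteq> rcosets\<^bsub>G\<^esub> ?Z" by (auto simp: T_def)
      have "S \<subseteq> \<theta> ` (rcosets\<^bsub>G\<^esub> ?Z)" using H.S_subset bij_betw_imp_surj_on[OF bij] by simp
      then show "\<theta> ` T = S" unfolding T_def by blast
    qed
    then show "card T = 4" using bij_betw_same_card H.card_S by metis
    fix x y assume xy: "x \<in> carrier G" "y \<in> carrier G"
    have "\<exists>h\<in>carrier H. \<theta> (?Z #>\<^bsub>G\<^esub> g) = ?W #>\<^bsub>H\<^esub> h" if "g \<in> carrier G" for g
      using bij_betwE[OF bij] cosG[OF that] by (auto simp: RCOSETS_def)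
    then obtain u v where uv: "u \<in> carrier H" "v \<in> carrier H"
      and \<theta>x: "\<theta> (?Z #>\<^bsub>G\<^esub> x) = ?W #>\<^bsub>H\<^esub> u" and \<theta>y: "\<theta> (?Z #>\<^bsub>G\<^esub> y) = ?W #>\<^bsub>H\<^esub> v"
      using xy by metis
    have \<theta>_eq: "?Z #>\<^bsub>G\<^esub> x = ?Z \<longleftrightarrow> ?W #>\<^bsub>H\<^esub> u = ?W" "?Z #>\<^bsub>G\<^esub> y = ?Z \<longleftrightarrow> ?W #>\<^bsub>H\<^esub> v = ?W"
      "?Z #>\<^bsub>G\<^esub> x = ?Z #>\<^bsub>G\<^esub> y \<longleftrightarrow> ?W #>\<^bsub>H\<^esub> u = ?W #>\<^bsub>H\<^esub> v"
      using inj_on_eq_iff[OF bij_betw_imp_inj_on[OF bij]] cosG xy ZG \<theta>_one \<theta>x \<theta>y by metis+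
    have T_iff: "?Z #>\<^bsub>G\<^esub> x \<in> T \<longleftrightarrow> ?W #>\<^bsub>H\<^esub> u \<in> S" "?Z #>\<^bsub>G\<^esub> y \<in> T \<longleftrightarrow> ?W #>\<^bsub>H\<^esub> v \<in> S"
      using cosG xy \<theta>x \<theta>y by (simp_all add: T_def)
    have \<phi>_one: "\<phi> w = \<one>\<^bsub>H\<^esub> \<longleftrightarrow> w = \<one>\<^bsub>G\<^esub>" if "w \<in> derived G (carrier G)" for w
    proof -
      have sub: "subgroup (derived G (carrier G)) G" "subgroup (derived H (carrier H)) H"
        by (simp_all add: G.derived_is_subgroup H.derived_is_subgroup)
      have "\<phi> \<one>\<^bsub>G\<^esub> = \<one>\<^bsub>H\<^esub>"
        using hom_one[of \<phi> "derived_subgroup G" "derived_subgroup H"] \<phi>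
          G.subgroup_imp_group[OF sub(1)] H.subgroup_imp_group[OF sub(2)]
        by (simp add: iso_def derived_subgroup_def)
      moreover have "inj_on \<phi> (derived G (carrier G))"
        using \<phi> by (simp add: iso_def bij_betw_def derived_subgroup_def)
      ultimately show ?thesis using that subgroup.one_closed[OF sub(1)] by (metis inj_onD)
    qed
    have "x \<otimes>\<^bsub>G\<^esub> y = y \<otimes>\<^bsub>G\<^esub> x \<longleftrightarrow> commutator G x y = \<one>\<^bsub>G\<^esub>"
      using G.commutator_eq_one_iff[OF xy] by simp
    also have "\<dots> \<longleftrightarrow> commutator H u v = \<one>\<^bsub>H\<^esub>"
      using \<phi>_one[OF G.commutator_mem_derived[OF xy]] comm[OF xy uv \<theta>x \<theta>y] by simp
    also have "\<dots> \<longleftrightarrow> u \<otimes>\<^bsub>H\<^esub> v = v \<otimes>\<^bsub>H\<^esub> u" using H.commutator_eq_one_iff[OF uv] .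
    finally show "x \<otimes>\<^bsub>G\<^esub> y = y \<otimes>\<^bsub>G\<^esub> x \<longleftrightarrow> ?Z #>\<^bsub>G\<^esub> x \<in> T \<and> ?Z #>\<^bsub>G\<^esub> y \<in> T \<or>
        ?Z #>\<^bsub>G\<^esub> x = ?Z \<or> ?Z #>\<^bsub>G\<^esub> y = ?Z \<or> ?Z #>\<^bsub>G\<^esub> x = ?Z #>\<^bsub>G\<^esub> y"
      unfolding H.commute_iff[OF uv] \<theta>_eq T_iff .
  qed
  then show ?thesis by blast
qed

section \<open>Counting orbits of tuples\<close>

context group
begin

lemma tuples_eq_lists: "tuples G n = {xs. set xs \<subseteq> carrier G \<and> length xs = n}"
  by (auto simp: tuples_def)

lemma invariants_simultaneous_conj:
  assumes "g \<in> carrier G" "E \<subseteq> tuples G n"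
  shows "invariants E (simultaneous_conj G E) g = {xs \<in> E. set xs \<subseteq> centralizer G g}"
proof -
  have "map (\<lambda>x. g \<otimes> x \<otimes> inv g) xs = xs \<longleftrightarrow> set xs \<subseteq> centralizer G g" if "xs \<in> E" for xs
  proof -
    have "set xs \<subseteq> carrier G" using that assms(2) by (auto simp: tuples_def)
    then have "(\<forall>x\<in>set xs. g \<otimes> x \<otimes> inv g = x) \<longleftrightarrow> set xs \<subseteq> centralizer G g"
      using conj_eq_iff_mem_centralizer[OF assms(1)] by blast
    then show ?thesis using map_eq_conv[of "\<lambda>x. g \<otimes> x \<otimes> inv g" xs "\<lambda>x. x"] by simp
  qed
  then show ?thesis by (auto simp: invariants_def simultaneous_conj_def)
qed

text \<open>Burnside's lemma: the tuples fixed by \<open>g\<close> are those with all entries in its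
  centralizer.\<close>

lemma alpha_mult_order:
  assumes fin: "finite (carrier G)"
  shows "alpha G n * order G = (\<Sum>g\<in>carrier G. card (centralizer G g) ^ n)"
proof -
  let ?E = "tuples G n"
  interpret act: group_action G ?E "simultaneous_conj G ?E"
    by (rule simultaneous_conj_action[where n = n]) simp
  have "finite ?E" unfolding tuples_eq_lists using fin by (rule finite_lists_length_eq)
  then have "alpha G n * order G =
      (\<Sum>g\<in>carrier G. card (invariants ?E (simultaneous_conj G ?E) g))"
    unfolding alpha_def using fin by (intro act.burnside)
  also have "\<dots> = (\<Sum>g\<in>carrier G. card (centralizer G g) ^ n)"
  proof (rule sum.cong[OF refl])
    fix g assume g: "g \<in> carrier G"
    have sub: "centralizer G g \<subseteq> carrier G" by (auto simp: centralizer_def)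
    then have "invariants ?E (simultaneous_conj G ?E) g =
        {xs. set xs \<subseteq> centralizer G g \<and> length xs = n}"
      unfolding invariants_simultaneous_conj[OF g order_refl] by (auto simp: tuples_def)
    then show "card (invariants ?E (simultaneous_conj G ?E) g) = card (centralizer G g) ^ n"
      using card_lists_length_eq finite_subset[OF sub fin] by simp
  qed
  finally show ?thesis .
qed

text \<open>In Burnside's lemma a pair of \<open>g\<close> and a commuting tuple fixed by
  \<open>g\<close> is the same as the commuting tuple prefixed by \<open>g\<close>, whence the shift
  from \<open>n\<close> to \<open>Suc n\<close>.\<close>

lemma beta_mult_order:
  assumes fin: "finite (carrier G)"
  shows "beta G n * order G = card (commuting_tuples G (Suc n))"
proof -
  let ?E = "commuting_tuples G n"
  interpret act: group_action G ?E "simultaneous_conj G ?E"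
    by (rule simultaneous_conj_action[where n = n]) simp
  have "finite (tuples G n)" unfolding tuples_eq_lists using fin by (rule finite_lists_length_eq)
  then have finE: "finite ?E" by (rule finite_subset[rotated]) (auto simp: commuting_tuples_def)
  then have "beta G n * order G =
      (\<Sum>g\<in>carrier G. card (invariants ?E (simultaneous_conj G ?E) g))"
    unfolding beta_def using fin by (intro act.burnside)
  also have "\<dots> = (\<Sum>g\<in>carrier G. card {xs \<in> ?E. set xs \<subseteq> centralizer G g})"
    by (intro sum.cong refl arg_cong[of _ _ card] invariants_simultaneous_conj[where n = n])
      (auto simp: commuting_tuples_def)
  also have "\<dots> = card (SIGMA g:carrier G. {xs \<in> ?E. set xs \<subseteq> centralizer G g})"
    using fin finE by (intro card_SigmaI[symmetric]) auto
  also have "\<dots> = card ((\<lambda>(g, xs). g # xs) ` (SIGMA g:carrier G. {xs \<in> ?E. set xs \<subseteq> centralizer G g}))"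
    by (intro card_image[symmetric]) (auto simp: inj_on_def)
  also have "(\<lambda>(g, xs). g # xs) ` (SIGMA g:carrier G. {xs \<in> ?E. set xs \<subseteq> centralizer G g}) =
      commuting_tuples G (Suc n)"
  proof (intro equalityI subsetI)
    fix ys assume "ys \<in> commuting_tuples G (Suc n)"
    then show "ys \<in> (\<lambda>(g, xs). g # xs) ` (SIGMA g:carrier G. {xs \<in> ?E. set xs \<subseteq> centralizer G g})"
      by (cases ys) (auto simp: commuting_tuples_def tuples_def centralizer_def)
  next
    fix ys assume "ys \<in> (\<lambda>(g, xs). g # xs) ` (SIGMA g:carrier G. {xs \<in> ?E. set xs \<subseteq> centralizer G g})"
    then obtain g xs where "ys = g # xs" "g \<in> carrier G" "xs \<in> ?E" "set xs \<subseteq> centralizer G g"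
      by auto
    then show "ys \<in> commuting_tuples G (Suc n)"
      by (fastforce simp: commuting_tuples_def tuples_def centralizer_def)
  qed
  finally show ?thesis .
qed

end

section \<open>Counts determined by the dihedral commutation pattern\<close>

context dihedral_commutation
begin

abbreviation "Z \<equiv> group_center G"

lemma center_card_pos: "card Z > 0"
  using finite_carrier order_eq order_gt_0_iff_finite by simp

lemma mem_Union_iff: "x \<in> carrier G \<Longrightarrow> x \<in> \<Union>S \<longleftrightarrow> Z #> x \<in> S"
  using S_subset rcos_self[OF _ subgroup_group_center] repr_independence[OF _ _ subgroup_group_center]
  by (auto simp: RCOSETS_def)

lemma Union_subset: "\<Union>S \<subseteq> carrier G"
  using S_subset rcosets_part_G[OF subgroup_group_center] by blast

lemma card_Union: "card (\<Union>S) = 4 * card Z"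
  using card_Union_rcosets[OF subgroup_group_center finite_carrier S_subset] card_S by simp

text \<open>In the three cases the centralizer is the whole group, \<open>\<Union>S\<close>, and
  \<open>Z \<union> (Z #> x)\<close>.\<close>

lemma card_centralizer:
  assumes x: "x \<in> carrier G"
  shows "card (centralizer G x) = (if x \<in> Z then 8 else if x \<in> \<Union>S then 4 else 2) * card Z"
proof -
  have Zx: "Z #> x = Z \<longleftrightarrow> x \<in> Z"
    using r_coset_eq_self_iff[OF subgroup_group_center x] .
  consider "x \<in> Z" | "x \<notin> Z" "x \<in> \<Union>S" | "x \<notin> Z" "x \<notin> \<Union>S" by blast
  then show ?thesis
  proof cases
    case 1
    then show ?thesis using centralizer_eq_carrier_iff[OF x] order_eq by (simp add: order_def)
  next
    case 2
    have "y \<in> centralizer G x \<longleftrightarrow> y \<in> \<Union>S" if "y \<in> carrier G" for y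
    proof -
      have "Z #> x \<in> S" using 2 mem_Union_iff x by blast
      then show ?thesis
        using commute_iff[OF x that] that mem_Union_iff[OF that] 2 Zx center_mem
        by (auto simp: centralizer_def)
    qed
    then have "centralizer G x = \<Union>S" using Union_subset by (auto simp: centralizer_def)
    then show ?thesis using card_Union 2 by simp
  next
    case 3
    have "y \<in> centralizer G x \<longleftrightarrow> y \<in> Z \<union> (Z #> x)" if y: "y \<in> carrier G" for y
    proof -
      have "Z #> x \<notin> S" using 3 mem_Union_iff x by blast
      moreover have "Z #> y = Z \<longleftrightarrow> y \<in> Z"
        using r_coset_eq_self_iff[OF subgroup_group_center y] .
      moreover have "Z #> x = Z #> y \<longleftrightarrow> y \<in> Z #> x"
        using x y repr_independence rcos_self subgroup_group_center by metis
      ultimately show ?thesis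
        using commute_iff[OF x y] y 3 Zx by (auto simp: centralizer_def)
    qed
    then have "centralizer G x = Z \<union> (Z #> x)"
      using group_center_subset r_coset_subset_G[OF group_center_subset x]
      by (auto simp: centralizer_def)
    moreover have "Z #> x \<in> rcosets Z" using x by (auto simp: RCOSETS_def)
    ultimately show ?thesis using card_center_Un_coset[OF finite_carrier] Zx 3 by simp
  qed
qed

text \<open>There are z central elements, 3z further ones in \<open>\<Union>S\<close> and 4z
  outside, where z = \<open>card Z\<close>; a common factor z is cancelled against the group order
  8z.\<close>

lemma alpha_eq:
  "8 * alpha G n = (8 * card Z) ^ n + 3 * (4 * card Z) ^ n + 4 * (2 * card Z) ^ n"
proof -
  let ?z = "card Z"
  have ZS: "Z \<subseteq> \<Union>S" using center_mem by blast
  have fin: "finite (\<Union>S)" "finite Z"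
    using finite_carrier Union_subset group_center_subset finite_subset by blast+
  let ?f = "\<lambda>g. card (centralizer G g) ^ n"
  have "alpha G n * order G = sum ?f (carrier G)"
    using alpha_mult_order finite_carrier by blast
  also have "\<dots> = sum ?f (carrier G - \<Union>S) + (sum ?f (\<Union>S - Z) + sum ?f Z)"
    using sum.subset_diff[OF Union_subset finite_carrier, of ?f] sum.subset_diff[OF ZS fin(1), of ?f]
    by simp
  also have "sum ?f (carrier G - \<Union>S) = (\<Sum>g\<in>carrier G - \<Union>S. (2 * ?z) ^ n)"
    using ZS by (intro sum.cong refl) (auto simp: card_centralizer)
  also have "sum ?f (\<Union>S - Z) = (\<Sum>g\<in>\<Union>S - Z. (4 * ?z) ^ n)"
    using Union_subset by (intro sum.cong refl) (simp add: card_centralizer subset_iff)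
  also have "sum ?f Z = (\<Sum>g\<in>Z. (8 * ?z) ^ n)"
    using group_center_subset by (intro sum.cong refl) (simp add: card_centralizer subset_iff)
  finally have *: "alpha G n * order G = (\<Sum>g\<in>carrier G - \<Union>S. (2 * ?z) ^ n)
      + ((\<Sum>g\<in>\<Union>S - Z. (4 * ?z) ^ n) + (\<Sum>g\<in>Z. (8 * ?z) ^ n))" .
  have "card (carrier G - \<Union>S) = 4 * ?z"
    using card_Diff_subset[OF fin(1) Union_subset] card_Union order_eq by (simp add: order_def)
  moreover have "card (\<Union>S - Z) = 3 * ?z"
    using card_Diff_subset[OF fin(2) ZS] card_Union by simp
  ultimately have "(8 * alpha G n) * ?z =
      ((8 * ?z) ^ n + 3 * (4 * ?z) ^ n + 4 * (2 * ?z) ^ n) * ?z"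
    using * order_eq by (simp add: algebra_simps)
  then show ?thesis using center_card_pos by simp
qed

text \<open>An entry \<open>x\<close> outside \<open>\<Union>S\<close> forces all entries into
  \<open>Z \<union> (Z #> x)\<close>. Tuples of central elements are removed from the second part
  because \<open>L (\<Union>S) n\<close> already contains them; this makes all the pieces
  disjoint.\<close>

lemma commuting_tuples_eq:
  defines "L \<equiv> \<lambda>B n. {xs. set xs \<subseteq> B \<and> length xs = n}"
  shows "commuting_tuples G n = L (\<Union>S) n \<union> (\<Union>R\<in>rcosets Z - S. L (Z \<union> R) n - L Z n)"
proof (intro equalityI subsetI)
  fix xs assume xs: "xs \<in> commuting_tuples G n"
  then have len: "length xs = n" and sub: "set xs \<subseteq> carrier G"
    and comm: "\<And>x y. x \<in> set xs \<Longrightarrow> y \<in> set xs \<Longrightarrow> x \<otimes> y = y \<otimes> x"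
    by (auto simp: commuting_tuples_def tuples_def)
  show "xs \<in> L (\<Union>S) n \<union> (\<Union>R\<in>rcosets Z - S. L (Z \<union> R) n - L Z n)"
  proof (cases "set xs \<subseteq> \<Union>S")
    case True
    then show ?thesis using len by (simp add: L_def)
  next
    case False
    then obtain x where x: "x \<in> set xs" "x \<notin> \<Union>S" by blast
    then have xc: "x \<in> carrier G" using sub by blast
    have ZxS: "Z #> x \<notin> S" using x xc mem_Union_iff by blast
    have xZ: "x \<notin> Z" using x center_mem by blast
    have "y \<in> Z \<union> (Z #> x)" if y: "y \<in> set xs" for y
    proof -
      have yc: "y \<in> carrier G" using y sub by blast
      have "Z #> x = Z \<or> Z #> y = Z \<or> Z #> x = Z #> y"
        using commute_iff[OF xc yc] comm[OF x(1) y] ZxS by blast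
      then show ?thesis
        using xZ r_coset_eq_self_iff[OF subgroup_group_center] xc yc
          rcos_self[OF yc subgroup_group_center] by auto
    qed
    then have "xs \<in> L (Z \<union> (Z #> x)) n - L Z n" using x(1) xZ len by (auto simp: L_def)
    moreover have "Z #> x \<in> rcosets Z - S" using ZxS xc by (auto simp: RCOSETS_def)
    ultimately show ?thesis by blast
  qed
next
  fix xs assume xs: "xs \<in> L (\<Union>S) n \<union> (\<Union>R\<in>rcosets Z - S. L (Z \<union> R) n - L Z n)"
  then have len: "length xs = n" by (auto simp: L_def)
  have "set xs \<subseteq> carrier G \<and> (\<forall>x\<in>set xs. \<forall>y\<in>set xs. x \<otimes> y = y \<otimes> x)"
  proof (cases "set xs \<subseteq> \<Union>S")
    case True
    moreover have "x \<otimes> y = y \<otimes> x" if "x \<in> \<Union>S" "y \<in> \<Union>S" for x y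
      using that commute_iff[of x y] mem_Union_iff[of x] mem_Union_iff[of y] Union_subset by blast
    ultimately show ?thesis using Union_subset by blast
  next
    case False
    then obtain R where R: "R \<in> rcosets Z" "set xs \<subseteq> Z \<union> R" using xs by (auto simp: L_def)
    then obtain g where g: "g \<in> carrier G" "R = Z #> g" by (auto simp: RCOSETS_def)
    have Rc: "R \<subseteq> carrier G" using g r_coset_subset_G[OF group_center_subset] by blast
    have Rg: "Z #> x = Z #> g" if "x \<in> R" for x
      using that g repr_independence subgroup_group_center by metis
    have "x \<otimes> y = y \<otimes> x" if x: "x \<in> Z \<union> R" and y: "y \<in> Z \<union> R" for x y
    proof -
      have xy: "x \<in> carrier G" "y \<in> carrier G" using x y Rc group_center_subset by blast+
      have "Z #> x = Z \<or> Z #> y = Z \<or> Z #> x = Z #> y"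
        using x y Rg r_coset_eq_self_iff[OF subgroup_group_center] xy by auto
      then show ?thesis using commute_iff[OF xy] by blast
    qed
    then show ?thesis using R(2) Rc group_center_subset by blast
  qed
  then show "xs \<in> commuting_tuples G n" using len by (simp add: commuting_tuples_def tuples_def)
qed

text \<open>Four cosets lie outside \<open>S\<close>, and each contributes the tuples over its union
  with the center minus the central ones. The subtracted term stands on the left to avoid truncated
  subtraction.\<close>

lemma card_commuting_tuples:
  "card (commuting_tuples G n) + 4 * card Z ^ n = (4 * card Z) ^ n + 4 * (2 * card Z) ^ n"
proof -
  let ?z = "card Z"
  define L where "L B = {xs. set xs \<subseteq> B \<and> length xs = n}" for B :: "'a set"
  have L: "card (L B) = card B ^ n" "finite (L B)" if "B \<subseteq> carrier G" for B
    using that finite_subset[OF that finite_carrier] card_lists_length_eq finite_lists_length_eq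
    by (simp_all add: L_def)
  have Rc: "R \<subseteq> carrier G" if "R \<in> rcosets Z" for R
    using that rcosets_part_G[OF subgroup_group_center] by blast
  have finR: "finite (rcosets Z)"
    using finite_carrier rcosets_part_G[OF subgroup_group_center] finite_UnionD by metis
  define D where "D R = L (Z \<union> R) - L Z" for R
  have cardD: "card (D R) + ?z ^ n = (2 * ?z) ^ n" if R: "R \<in> rcosets Z - S" for R
  proof -
    have "L Z \<subseteq> L (Z \<union> R)" by (auto simp: L_def)
    moreover have "card (L (Z \<union> R)) = (2 * ?z) ^ n"
      using R Rc group_center_subset L(1) card_center_Un_coset[OF finite_carrier] center_mem by (metis DiffE Un_least)
    moreover have "card (L Z) = ?z ^ n" "finite (L Z)" "finite (L (Z \<union> R))"
      using L group_center_subset R Rc by auto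
    ultimately show ?thesis unfolding D_def by (metis card_Diff_subset card_mono le_add_diff_inverse2)
  qed
  have disj: "R \<inter> R' = {}" if "R \<in> rcosets Z" "R' \<in> rcosets Z" "R \<noteq> R'" for R R'
    using that rcos_disjoint[OF subgroup_group_center] by (metis disjnt_def pairwiseD)
  have "commuting_tuples G n = L (\<Union>S) \<union> (\<Union>R\<in>rcosets Z - S. D R)"
    unfolding commuting_tuples_eq L_def D_def ..
  moreover have "L (\<Union>S) \<inter> (\<Union>R\<in>rcosets Z - S. D R) = {}"
  proof -
    have "R \<inter> \<Union>S = {}" if "R \<in> rcosets Z - S" for R
      using that disj S_subset by blast
    then show ?thesis by (fastforce simp: D_def L_def)
  qed
  moreover have finD: "finite (D R)" if "R \<in> rcosets Z - S" for R
    using that Rc group_center_subset L(2) by (auto simp: D_def)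
  ultimately have "card (commuting_tuples G n) = card (L (\<Union>S)) + card (\<Union>R\<in>rcosets Z - S. D R)"
    using L(2)[OF Union_subset] finR by (simp add: card_Un_disjoint)
  also have "card (\<Union>R\<in>rcosets Z - S. D R) = (\<Sum>R\<in>rcosets Z - S. card (D R))"
  proof (rule card_UN_disjoint)
    show "\<forall>R\<in>rcosets Z - S. \<forall>R'\<in>rcosets Z - S. R \<noteq> R' \<longrightarrow> D R \<inter> D R' = {}"
      using disj by (fastforce simp: D_def L_def)
  qed (use finR finD in auto)
  finally have *: "card (commuting_tuples G n) = (4 * ?z) ^ n + (\<Sum>R\<in>rcosets Z - S. card (D R))"
    using L(1)[OF Union_subset] card_Union by simp
  have "card (rcosets Z) = 8"
    using lagrange[OF subgroup_group_center] order_eq center_card_pos by simp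
  then have "card (rcosets Z - S) = 4"
    using card_Diff_subset[OF _ S_subset] finR S_subset card_S finite_subset by fastforce
  then have "(\<Sum>R\<in>rcosets Z - S. card (D R)) + 4 * ?z ^ n = (\<Sum>R\<in>rcosets Z - S. card (D R) + ?z ^ n)"
    by (simp add: sum.distrib)
  also have "\<dots> = (\<Sum>R\<in>rcosets Z - S. (2 * ?z) ^ n)"
    using cardD by (rule sum.cong[OF refl])
  finally show ?thesis using * \<open>card (rcosets Z - S) = 4\<close> by simp
qed

lemma rescale_A_series:
  "rescale (1 / of_nat (order G)) (A_series G) =
     simple_fraction (1 - 1 / 2) (1 / 2 ^ 2)
     + simple_fraction (1 / 2 - 1 / 2 ^ 3) (1 / 2)
     + simple_fraction (1 / 2 ^ 3) 1"
proof (rule fps_ext)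
  fix n
  define z :: rat where "z = of_nat (card Z)"
  have z: "z \<noteq> 0" using center_card_pos by (simp add: z_def)
  have "of_nat (8 * alpha G n) = (8 * z) ^ n + 3 * (4 * z) ^ n + 4 * (2 * z) ^ n"
    unfolding alpha_eq z_def by simp
  then have \<alpha>: "of_nat (alpha G n) = ((8 * z) ^ n + 3 * (4 * z) ^ n + 4 * (2 * z) ^ n) / 8"
    by simp
  \<comment> \<open>Here the order of the center cancels.\<close>
  have pow: "(1 / (8 * z)) ^ n * (c * z) ^ n = (c / 8) ^ n" for c
    using z by (simp flip: power_mult_distrib)
  have "(1 / (8 * z)) ^ n * of_nat (alpha G n) =
      ((8 / 8) ^ n + 3 * (4 / 8) ^ n + 4 * (2 / 8) ^ n) / 8"
    unfolding \<alpha> pow[symmetric] by (simp add: algebra_simps add_divide_distrib)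
  then show "fps_nth (rescale (1 / of_nat (order G)) (A_series G)) n = fps_nth
     (simple_fraction (1 - 1 / 2) (1 / 2 ^ 2)
     + simple_fraction (1 / 2 - 1 / 2 ^ 3) (1 / 2)
     + simple_fraction (1 / 2 ^ 3) 1) n"
    by (simp add: rescale_nth simple_fraction_nth A_series_def order_eq z_def[symmetric] field_simps)
qed

lemma rescale_B_series:
  "rescale (1 / of_nat (order G)) (B_series G) =
     simple_fraction (- (1 / 2)) (1 / 2 ^ 3)
     + simple_fraction 1 (1 / 2 ^ 2)
     + simple_fraction (1 / 2) (1 / 2)"
proof (rule fps_ext)
  fix n
  define z :: rat where "z = of_nat (card Z)"
  have z: "z \<noteq> 0" using center_card_pos by (simp add: z_def)
  have "beta G n * (8 * card Z) + 4 * card Z ^ Suc n =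
      (4 * card Z) ^ Suc n + 4 * (2 * card Z) ^ Suc n"
    using card_commuting_tuples[of "Suc n"] beta_mult_order[OF finite_carrier, of n] order_eq by simp
  then have "of_nat (beta G n * (8 * card Z) + 4 * card Z ^ Suc n) =
      (of_nat ((4 * card Z) ^ Suc n + 4 * (2 * card Z) ^ Suc n) :: rat)" by simp
  \<comment> \<open>The common factor is 4z; 4 is cancelled first and z, being nonzero, in the next
    step.\<close>
  then have "z * (2 * of_nat (beta G n) + z ^ n) = z * ((4 * z) ^ n + 2 * (2 * z) ^ n)"
    unfolding of_nat_add of_nat_mult of_nat_power z_def[symmetric] by (simp add: algebra_simps)
  \<comment> \<open>The form \<open>1 * z\<close> brings the last power into the shape
    \<open>(c * z) ^ n\<close> required by \<open>pow\<close>.\<close>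
  then have \<beta>: "of_nat (beta G n) = ((4 * z) ^ n + 2 * (2 * z) ^ n - (1 * z) ^ n) / 2"
    using z by simp
  have pow: "(1 / (8 * z)) ^ n * (c * z) ^ n = (c / 8) ^ n" for c
    using z by (simp flip: power_mult_distrib)
  have "(1 / (8 * z)) ^ n * of_nat (beta G n) =
      ((4 / 8) ^ n + 2 * (2 / 8) ^ n - (1 / 8) ^ n) / 2"
    unfolding \<beta> pow[symmetric] by (simp add: algebra_simps add_divide_distrib diff_divide_distrib)
  then show "fps_nth (rescale (1 / of_nat (order G)) (B_series G)) n = fps_nth
     (simple_fraction (- (1 / 2)) (1 / 2 ^ 3)
     + simple_fraction 1 (1 / 2 ^ 2)
     + simple_fraction (1 / 2) (1 / 2)) n"
    by (simp add: rescale_nth simple_fraction_nth B_series_def order_eq z_def[symmetric] field_simps)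
qed

end

section \<open>From rank four to the two generating functions\<close>

theorem lemma5p13:
  fixes G :: "('a, 'b) monoid_scheme" and m :: nat
  assumes "group G"
    and "order G = 2 ^ m"
    and "family_rank G = 4"
  shows "rescale (1 / of_nat (order G)) (A_series G) =
           simple_fraction (1 - 1 / 2) (1 / 2 ^ 2)
           + simple_fraction (1 / 2 - 1 / 2 ^ 3) (1 / 2)
           + simple_fraction (1 / 2 ^ 3) 1
         \<and> rescale (1 / of_nat (order G)) (B_series G) =
           simple_fraction (- (1 / 2)) (1 / 2 ^ 3)
           + simple_fraction 1 (1 / 2 ^ 2)
           + simple_fraction (1 / 2) (1 / 2)"
proof -
  have fin: "finite (carrier G)"
    using assms(2) by (intro card_ge_0_finite) (simp add: order_def)
  obtain H where H: "H \<in> isoclinism_family G" and "order H = 2 ^ family_rank G"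
    using family_rank_attained assms(1,2) by blast
  then have ord: "order H = 16" and H: "group H" "isoclinic G H"
    using assms(3) by (auto simp: isoclinism_family_def)
  have "group_center H \<noteq> carrier H"
  proof
    assume "group_center H = carrier H"
    note E = isoclinic_trivial[OF H(1) this]
    have "family_rank G \<le> 0"
      using E isoclinic_trans[OF H(2) E(3)] by (intro family_rank_le) auto
    then show False using assms(3) by simp
  qed
  moreover have "\<not> center_index_four H"
  proof
    assume "center_index_four H"
    then have "isoclinic G dihedral_eight"
      using isoclinic_center_index_four center_index_four_dihedral_eight isoclinic_trans H(2) by blast
    then have "family_rank G \<le> 3"
      using group_dihedral_eight order_dihedral_eight by (intro family_rank_le) auto
    then show False using assms(3) by simp
  qed
  ultimately obtain S where "dihedral_commutation H S"
    using dihedral_commutation_order_sixteen[OF H(1) ord] by blast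
  \<comment> \<open>The pattern passes from the representative of order 16 back to \<open>G\<close>,
    whose center may have any order.\<close>
  then obtain T where "dihedral_commutation G T"
    using dihedral_commutation_isoclinic assms(1) fin H(2) by blast
  then interpret dihedral_commutation G T .
  show ?thesis using rescale_A_series rescale_B_series by blast
qed

end
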